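(* Let $m,n,k,d,l$ be non-negative integers and $L,D$ be metrizable spaces such that $L$ has the $0$-$\overline{\mathrm{DD}}{}^{\{0,0\}}$-property and $D$ has the $0$-$\overline{\mathrm{DD}}{}^{\{0,d+l\}}$-property. If $m+n+k<2d+l$, then the product $D^d\times L^l$ has the $m$-$\overline{\mathrm{DD}}{}^{\{n,k\}}$-property.
   Context: All maps are continuous; $\mathbb I=[0,1]$. Two maps $f,g:K\to X$ are $\mathcal U$-homotopic, for a cover $\mathcal U$ of $X$, if there is a homotopy $h:K\times[0,1]\to X$ from $f$ to $g$ such that for each $x\in K$ the set $h(\{x\}\times[0,1])$ lies in some $U\in\mathcal U$. For non-negative integers $m,n,k$, a space $X$ has the $m$-$\overline{\mathrm{DD}}{}^{\{n,k\}}$-property if for any open cover $\mathcal U$ of $X$ and any maps $f:\mathbb I^m\times\mathbb I^n\to X$, $g:\mathbb I^m\times\mathbb I^k\to X$ there are maps $f':\mathbb I^m\times\mathbb I^n\to X$, $g':\mathbb I^m\times\mathbb I^k\to X$ such that $f'$ is $\mathcal U$-homotopic to $f$, $g'$ is $\mathcal U$-homotopic to $g$, and $f'(\{z\}\times\mathbb I^n)\cap g'(\{z\}\times\mathbb I^k)=\varnothing$ for all $z\in\mathbb I^m$. *)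

theory Defs
  imports "HOL-Analysis.Analysis"
begin

definition power_topology :: "'a topology \<Rightarrow> nat \<Rightarrow> (nat \<Rightarrow> 'a) topology"
  where "power_topology X n = product_topology (\<lambda>_. X) {..<n}"

definition cube :: "nat \<Rightarrow> (nat \<Rightarrow> real) topology"
  where "cube n = power_topology (top_of_set {0..1}) n"

definition open_cover :: "'a topology \<Rightarrow> 'a set set \<Rightarrow> bool"
  where "open_cover X \<U> \<longleftrightarrow> (\<forall>U\<in>\<U>. openin X U) \<and> \<Union>\<U> = topspace X"

definition cover_homotopic ::
    "'a topology \<Rightarrow> 'b topology \<Rightarrow> 'b set set \<Rightarrow> ('a \<Rightarrow> 'b) \<Rightarrow> ('a \<Rightarrow> 'b) \<Rightarrow> bool"
  where "cover_homotopic K X \<U> f g \<longleftrightarrow>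
    (\<exists>h. continuous_map (prod_topology K (top_of_set {0..1::real})) X h \<and>
         (\<forall>x\<in>topspace K. h (x, 0) = f x) \<and>
         (\<forall>x\<in>topspace K. h (x, 1) = g x) \<and>
         (\<forall>x\<in>topspace K. \<exists>U\<in>\<U>. h ` ({x} \<times> {0..1}) \<subseteq> U))"

(* fibered_DD m n k X is the m-DD^{n,k} property (with overline and braces) of the space X;
   the maps are only relevant on the carriers of their domains. *)
definition fibered_DD :: "nat \<Rightarrow> nat \<Rightarrow> nat \<Rightarrow> 'a topology \<Rightarrow> bool"
  where "fibered_DD m n k X \<longleftrightarrow>
    (\<forall>\<U> f g. open_cover X \<U> \<longrightarrow>
       continuous_map (prod_topology (cube m) (cube n)) X f \<longrightarrow>
       continuous_map (prod_topology (cube m) (cube k)) X g \<longrightarrow>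
       (\<exists>f' g'.
          continuous_map (prod_topology (cube m) (cube n)) X f' \<and>
          continuous_map (prod_topology (cube m) (cube k)) X g' \<and>
          cover_homotopic (prod_topology (cube m) (cube n)) X \<U> f' f \<and>
          cover_homotopic (prod_topology (cube m) (cube k)) X \<U> g' g \<and>
          (\<forall>z\<in>topspace (cube m).
             f' ` ({z} \<times> topspace (cube n)) \<inter> g' ` ({z} \<times> topspace (cube k)) = {})))"

end

theory Submission
  imports Defs
begin

text \<open>
  No local connectedness is available, so maps are deformed by precomposition. Collapsing the unit
  interval onto a grid of mesh $1/N$, except on small gaps, moves points of a cube by at most $1/N$, and
  after precomposing with the collapse only the values of a map at grid points matter outside the gaps,
  and only those on the lines through grid points where a single coordinate lies in a gap. The gaps can
  be chosen in $2d+l$ pairwise disjoint colours.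

  In the $j$-th factor $L$ collapse both maps with the same colour $2d+j$. After finitely many small
  pushes their values at grid points differ, so the factor separates two points over the same $z$
  unless some coordinate lies in a gap of that colour. In the $i$-th factor $D$ collapse the first map
  with colour $i$ and the second with colour $d+i$. Pushing points off arcs makes each map at grid points
  differ from the other one at grid points and on coordinate lines, so this factor separates unless
  at least two coordinates lie in gaps of its two colours. If no factor separated, at least $2d+l$ of the
  $m+n+k$ coordinates would lie in gaps, which is impossible.
\<close>

section \<open>Homotopies controlled by a metric\<close>

text \<open>The two maps are compared only over a common z, so a coordinate of z lying in a gap
  disturbs both at once. This is why they get different colours in a factor D: with one colour, a
  single coordinate of z could move both values off the grid onto lines, and pushing points off arcs
  does not separate two lines. With different colours two distinct coordinates must be spent. In a
  factor L one bad coordinate already spoils the separation, so a second colour would gain nothing.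

  Colours are disjoint only for a common mesh, so one N must serve all factors; hence the separation
  results are stated for all large N. The points to be pushed depend on N, so N is fixed from the
  continuity of the given maps before anything is pushed.

  The hypotheses deform a map only on a point or an arc. These are retracts of the cube, and it is
  the geometry of the cube, not of the target, that extends the deformation.\<close>

lemma continuous_map_compose2:
  assumes "continuous_map Y Z h" "continuous_map X Y k"
  shows "continuous_map X Z (\<lambda>x. h (k x))"
  using continuous_map_compose[OF assms(2,1)] by (simp add: o_def)

lemma continuous_map_fst_compose:
  "continuous_map X Z f \<Longrightarrow> continuous_map (prod_topology X Y) Z (\<lambda>x. f (fst x))"
  by (rule continuous_map_compose2[OF _ continuous_map_fst])

lemma continuous_map_snd_compose:
  "continuous_map Y Z f \<Longrightarrow> continuous_map (prod_topology X Y) Z (\<lambda>x. f (snd x))"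
  by (rule continuous_map_compose2[OF _ continuous_map_snd])

text \<open>Clamping makes every reparametrised time a continuous map into the unit interval on its
  whole domain, so homotopies can be reversed, concatenated and cut off without range conditions.
  The same function later serves as the ramp of the grid collapse.\<close>

definition clamp01 :: "real \<Rightarrow> real"
  where "clamp01 y = max 0 (min 1 y)"

lemma clamp01_bounds [simp]: "0 \<le> clamp01 y" "clamp01 y \<le> 1"
  by (auto simp: clamp01_def)

lemma clamp01_id: "0 \<le> y \<Longrightarrow> y \<le> 1 \<Longrightarrow> clamp01 y = y"
  and clamp01_le0: "y \<le> 0 \<Longrightarrow> clamp01 y = 0"
  and clamp01_ge1: "y \<ge> 1 \<Longrightarrow> clamp01 y = 1"
  by (auto simp: clamp01_def)

lemma continuous_map_clamp01:
  assumes "continuous_map X euclideanreal f"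
  shows "continuous_map X (top_of_set {0..1}) (\<lambda>x. clamp01 (f x))"
  unfolding continuous_map_in_subtopology
proof
  show "continuous_map X euclideanreal (\<lambda>x. clamp01 (f x))"
    unfolding clamp01_def by (intro continuous_intros assms)
qed auto

lemma continuous_map_snd_real:
  "continuous_map (prod_topology X (top_of_set A)) euclideanreal snd"
  by (rule continuous_map_into_fulltopology[OF continuous_map_snd])

lemma continuous_map_at_time:
  assumes "continuous_map (prod_topology K (top_of_set {0..1::real})) X h" "t \<in> {0..1}"
  shows "continuous_map K X (\<lambda>x. h (x, t))"
  by (rule continuous_map_compose2[OF assms(1)]) (use assms(2) in \<open>intro continuous_intros, auto\<close>)

text \<open>The control is measured from the starting map only. Concatenation then adds the bounds
  by one triangle inequality, and continuity of both ends comes from the homotopy itself.\<close>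

definition close_homotopic ::
    "'k topology \<Rightarrow> 'a metric \<Rightarrow> real \<Rightarrow> ('k \<Rightarrow> 'a) \<Rightarrow> ('k \<Rightarrow> 'a) \<Rightarrow> bool"
  where "close_homotopic K m \<epsilon> f g \<longleftrightarrow>
    (\<exists>h. continuous_map (prod_topology K (top_of_set {0..1::real})) (mtopology_of m) h \<and>
         (\<forall>x\<in>topspace K. h (x, 0) = f x \<and> h (x, 1) = g x) \<and>
         (\<forall>x\<in>topspace K. \<forall>t\<in>{0..1}. mdist m (f x) (h (x, t)) < \<epsilon>))"

lemma close_homotopicD:
  assumes "close_homotopic K m \<epsilon> f g"
  shows "continuous_map K (mtopology_of m) f" "continuous_map K (mtopology_of m) g"
    "x \<in> topspace K \<Longrightarrow> mdist m (f x) (g x) < \<epsilon>"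
proof -
  obtain h where h: "continuous_map (prod_topology K (top_of_set {0..1::real})) (mtopology_of m) h"
    and e: "\<And>x. x \<in> topspace K \<Longrightarrow> h (x, 0) = f x \<and> h (x, 1) = g x"
    and c: "\<And>x t. x \<in> topspace K \<Longrightarrow> t \<in> {0..1} \<Longrightarrow> mdist m (f x) (h (x, t)) < \<epsilon>"
    using assms unfolding close_homotopic_def by blast
  show "continuous_map K (mtopology_of m) f"
    using continuous_map_eq[OF continuous_map_at_time[OF h, of 0]] e by simp
  show "continuous_map K (mtopology_of m) g"
    using continuous_map_eq[OF continuous_map_at_time[OF h, of 1]] e by simp
  show "x \<in> topspace K \<Longrightarrow> mdist m (f x) (g x) < \<epsilon>"
    using e[of x] c[of x 1] by simp
qed

lemma continuous_map_mspace:
  "continuous_map K (mtopology_of m) f \<Longrightarrow> x \<in> topspace K \<Longrightarrow> f x \<in> mspace m"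
  by (auto simp: continuous_map_def)

lemma mdist_self: "x \<in> mspace m \<Longrightarrow> mdist m x x = 0"
  by (simp only: mdist_zero)

lemma close_homotopic_refl:
  assumes "continuous_map K (mtopology_of m) f" "0 < \<epsilon>"
  shows "close_homotopic K m \<epsilon> f f"
  unfolding close_homotopic_def
proof (intro exI[of _ "\<lambda>x. f (fst x)"] conjI ballI)
  show "continuous_map (prod_topology K (top_of_set {0..1})) (mtopology_of m) (\<lambda>x. f (fst x))"
    by (rule continuous_map_fst_compose[OF assms(1)])
  show "mdist m (f x) (f (fst (x, t))) < \<epsilon>" if "x \<in> topspace K" for x and t :: real
    using mdist_self[OF continuous_map_mspace[OF assms(1) that]] assms(2) by simp
qed simp_all

lemma close_homotopic_mono:
  "close_homotopic K m \<epsilon> f g \<Longrightarrow> \<epsilon> \<le> \<epsilon>' \<Longrightarrow> close_homotopic K m \<epsilon>' f g"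
  unfolding close_homotopic_def by (elim exE conjE, rule exI, intro conjI) (assumption, assumption, force)

lemma close_homotopic_trans:
  assumes fg: "close_homotopic K m \<epsilon> f g" and gk: "close_homotopic K m \<delta> g k" and pos: "0 < \<delta>"
  shows "close_homotopic K m (\<epsilon> + \<delta>) f k"
proof -
  let ?KI = "prod_topology K (top_of_set {0..1::real})"
  obtain h1 where h1: "continuous_map ?KI (mtopology_of m) h1"
    and e1: "\<And>x. x \<in> topspace K \<Longrightarrow> h1 (x, 0) = f x \<and> h1 (x, 1) = g x"
    and c1: "\<And>x t. x \<in> topspace K \<Longrightarrow> t \<in> {0..1} \<Longrightarrow> mdist m (f x) (h1 (x, t)) < \<epsilon>"
    using fg unfolding close_homotopic_def by blast
  obtain h2 where h2: "continuous_map ?KI (mtopology_of m) h2"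
    and e2: "\<And>x. x \<in> topspace K \<Longrightarrow> h2 (x, 0) = g x \<and> h2 (x, 1) = k x"
    and c2: "\<And>x t. x \<in> topspace K \<Longrightarrow> t \<in> {0..1} \<Longrightarrow> mdist m (g x) (h2 (x, t)) < \<delta>"
    using gk unfolding close_homotopic_def by blast
  define h where "h = (\<lambda>z. if snd z \<le> 1/2 then h1 (fst z, clamp01 (2 * snd z))
                            else h2 (fst z, clamp01 (2 * snd z - 1)))"
  have "continuous_map ?KI (mtopology_of m) h"
    unfolding h_def
  proof (rule continuous_map_cases_le)
    show "continuous_map ?KI euclideanreal snd" by (rule continuous_map_snd_real)
    show "continuous_map (subtopology ?KI {x \<in> topspace ?KI. snd x \<le> 1/2}) (mtopology_of m)
       (\<lambda>z. h1 (fst z, clamp01 (2 * snd z)))"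
      by (intro continuous_map_from_subtopology continuous_map_compose2[OF h1] continuous_map_pairedI
            continuous_map_fst continuous_map_clamp01 continuous_map_real_mult_left continuous_map_snd_real)
    show "continuous_map (subtopology ?KI {x \<in> topspace ?KI. 1/2 \<le> snd x}) (mtopology_of m)
       (\<lambda>z. h2 (fst z, clamp01 (2 * snd z - 1)))"
      by (intro continuous_map_from_subtopology continuous_map_compose2[OF h2] continuous_map_pairedI
            continuous_map_fst continuous_map_clamp01 continuous_map_diff continuous_map_real_mult_left continuous_map_snd_real)
         auto
    show "h1 (fst z, clamp01 (2 * snd z)) = h2 (fst z, clamp01 (2 * snd z - 1))"
      if "z \<in> topspace ?KI" "snd z = 1/2" for z
      using that e1[of "fst z"] e2[of "fst z"] by (auto simp: clamp01_def)
  qed auto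
  moreover have "h (x, 0) = f x \<and> h (x, 1) = k x" if "x \<in> topspace K" for x
    using that e1[of x] e2[of x] by (simp add: h_def clamp01_def)
  moreover have "mdist m (f x) (h (x, t)) < \<epsilon> + \<delta>" if x: "x \<in> topspace K" and t: "t \<in> {0..1}" for x t
  proof (cases "t \<le> 1/2")
    case True
    then show ?thesis using c1[OF x, of "clamp01 (2*t)"] pos by (simp add: h_def)
  next
    case False
    let ?y = "h2 (x, clamp01 (2*t - 1))"
    have m: "f x \<in> mspace m" "g x \<in> mspace m"
      using x close_homotopicD(1,2)[OF fg] by (auto intro: continuous_map_mspace)
    have "?y \<in> mspace m"
      using x by (intro continuous_map_mspace[OF h2]) auto
    then have "mdist m (f x) ?y \<le> mdist m (f x) (g x) + mdist m (g x) ?y"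
      using m by (intro mdist_triangle)
    also have "\<dots> < \<epsilon> + \<delta>"
      using c2[OF x, of "clamp01 (2*t - 1)"] close_homotopicD(3)[OF fg x] by simp
    finally show ?thesis using False by (simp add: h_def)
  qed
  ultimately show ?thesis
    unfolding close_homotopic_def by blast
qed

lemma close_homotopic_compose:
  assumes "close_homotopic K m \<epsilon> f g" "continuous_map J K k"
  shows "close_homotopic J m \<epsilon> (\<lambda>x. f (k x)) (\<lambda>x. g (k x))"
proof -
  obtain h where h: "continuous_map (prod_topology K (top_of_set {0..1::real})) (mtopology_of m) h"
    and e: "\<And>x. x \<in> topspace K \<Longrightarrow> h (x, 0) = f x \<and> h (x, 1) = g x"
    and c: "\<And>x t. x \<in> topspace K \<Longrightarrow> t \<in> {0..1} \<Longrightarrow> mdist m (f x) (h (x, t)) < \<epsilon>"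
    using assms(1) unfolding close_homotopic_def by blast
  have "continuous_map (prod_topology J (top_of_set {0..1::real})) (mtopology_of m) (\<lambda>z. h (k (fst z), snd z))"
    by (intro continuous_map_compose2[OF h] continuous_map_pairedI continuous_map_fst_compose
          assms(2) continuous_map_snd)
  moreover have "k x \<in> topspace K" if "x \<in> topspace J" for x
    using assms(2) that by (auto simp: continuous_map_def)
  ultimately show ?thesis
    unfolding close_homotopic_def using e c by (intro exI[of _ "\<lambda>z. h (k (fst z), snd z)"]) auto
qed

text \<open>Uniform continuity in a form that needs no metric on the domain.\<close>
lemma compact_space_control:
  assumes "compact_space Z" "continuous_map Z euclideanreal a" "continuous_map Z euclideanreal b"
    and "\<And>z. z \<in> topspace Z \<Longrightarrow> 0 \<le> a z" "\<And>z. z \<in> topspace Z \<Longrightarrow> a z = 0 \<Longrightarrow> b z < \<epsilon>"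
  shows "\<exists>\<delta>>0. \<forall>z\<in>topspace Z. a z < \<delta> \<longrightarrow> b z < \<epsilon>"
proof -
  \<comment> \<open>\<open>?C\<close> collects the points violating the bound on \<open>b\<close>.
    It is compact and \<open>a\<close> is positive on it, so the minimum of \<open>a\<close> over
    \<open>?C\<close> serves as \<delta>.\<close>
  let ?C = "{z \<in> topspace Z. b z \<in> {\<epsilon>..}}"
  have "closedin Z ?C"
    using closedin_continuous_map_preimage[OF assms(3), of "{\<epsilon>..}"] by simp
  then have "compactin Z ?C"
    using assms(1) closedin_compact_space by blast
  then have cpt: "compact (a ` ?C)"
    using image_compactin[OF _ assms(2)] by simp
  show ?thesis
  proof (cases "?C = {}")
    case True
    then show ?thesis by (intro exI[of _ 1]) force
  next
    case False
    then obtain z where z: "z \<in> ?C" "\<And>w. w \<in> ?C \<Longrightarrow> a z \<le> a w"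
      using compact_attains_inf[OF cpt] by blast
    then have "a z > 0"
      using assms(4,5)[of z] by force
    then show ?thesis
      using z by (intro exI[of _ "a z"]) force
  qed
qed

section \<open>Cubes and extension of small homotopies\<close>

text \<open>Indexing by an arbitrary set lets a disjoint sum of index sets turn a product of two
  cubes into a single cube, whose coordinates are then counted uniformly.\<close>

definition ucube :: "'s set \<Rightarrow> ('s \<Rightarrow> real) topology"
  where "ucube S = product_topology (\<lambda>_. top_of_set {0..1}) S"

lemma topspace_ucube: "topspace (ucube S) = PiE S (\<lambda>_. {0..1})"
  by (simp add: ucube_def)

lemma compact_space_ucube: "compact_space (ucube S)"
  unfolding ucube_def compact_space_product_topology
  by (simp add: compact_space_subtopology)

lemma continuous_map_ucube_iff:
  "continuous_map X (ucube S) f \<longleftrightarrow>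
    f \<in> topspace X \<rightarrow> extensional S \<and> (\<forall>s\<in>S. continuous_map X (top_of_set {0..1}) (\<lambda>x. f x s))"
  by (auto simp: ucube_def continuous_map_componentwise)

lemma continuous_map_ucube_coord: "s \<in> S \<Longrightarrow> continuous_map (ucube S) (top_of_set {0..1}) (\<lambda>x. x s)"
  using continuous_map_product_projection[of s S "\<lambda>_. top_of_set {0..1}"] by (simp add: ucube_def)

lemma continuous_map_ucube_component:
  "continuous_map X (ucube S) f \<Longrightarrow> s \<in> S \<Longrightarrow> continuous_map X euclideanreal (\<lambda>x. f x s)"
  by (rule continuous_map_into_fulltopology) (auto simp: continuous_map_ucube_iff)

lemma ucube_coord_bounds: "x \<in> topspace (ucube S) \<Longrightarrow> s \<in> S \<Longrightarrow> 0 \<le> x s \<and> x s \<le> 1"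
  by (fastforce simp: topspace_ucube)

definition segment :: "'s set \<Rightarrow> real \<Rightarrow> ('s \<Rightarrow> real) \<Rightarrow> ('s \<Rightarrow> real) \<Rightarrow> 's \<Rightarrow> real"
  where "segment S t x y = (\<lambda>s\<in>S. (1 - t) * x s + t * y s)"

definition dist1 :: "'s set \<Rightarrow> ('s \<Rightarrow> real) \<Rightarrow> ('s \<Rightarrow> real) \<Rightarrow> real"
  where "dist1 S x y = (\<Sum>s\<in>S. \<bar>x s - y s\<bar>)"

lemma segment_ends:
  assumes "x \<in> topspace (ucube S)" "y \<in> topspace (ucube S)"
  shows "segment S 0 x y = x" "segment S 1 x y = y" "segment S t x x = x"
  using assms unfolding segment_def topspace_ucube
  by (auto simp: fun_eq_iff algebra_simps extensional_def PiE_def)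

lemma dist1_nonneg: "0 \<le> dist1 S x y"
  by (simp add: dist1_def sum_nonneg)

lemma dist1_eq_0:
  assumes "finite S" "x \<in> topspace (ucube S)" "y \<in> topspace (ucube S)"
  shows "dist1 S x y = 0 \<longleftrightarrow> x = y"
proof
  assume "dist1 S x y = 0"
  then have "\<And>s. s \<in> S \<Longrightarrow> x s = y s"
    using assms(1) by (auto simp: dist1_def sum_nonneg_eq_0_iff)
  then show "x = y"
    using assms(2,3) unfolding topspace_ucube by (meson PiE_ext)
qed (simp add: dist1_def)

lemma continuous_map_dist1:
  assumes "finite S" "continuous_map X (ucube S) f" "continuous_map X (ucube S) g"
  shows "continuous_map X euclideanreal (\<lambda>x. dist1 S (f x) (g x))"
  unfolding dist1_def
  by (intro continuous_intros assms(1) continuous_map_ucube_component[OF assms(2)]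
      continuous_map_ucube_component[OF assms(3)])

lemma continuous_map_segment:
  assumes "continuous_map X (top_of_set {0..1}) \<tau>" "continuous_map X (ucube S) f" "continuous_map X (ucube S) g"
  shows "continuous_map X (ucube S) (\<lambda>x. segment S (\<tau> x) (f x) (g x))"
  unfolding continuous_map_ucube_iff
proof (intro conjI ballI)
  show "(\<lambda>x. segment S (\<tau> x) (f x) (g x)) \<in> topspace X \<rightarrow> extensional S"
    by (auto simp: segment_def)
  fix s assume s: "s \<in> S"
  show "continuous_map X (top_of_set {0..1}) (\<lambda>x. segment S (\<tau> x) (f x) (g x) s)"
    unfolding continuous_map_in_subtopology
  proof
    have "continuous_map X euclideanreal (\<lambda>x. (1 - \<tau> x) * f x s + \<tau> x * g x s)"
      by (intro continuous_intros continuous_map_ucube_component[OF assms(2) s]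
           continuous_map_ucube_component[OF assms(3) s] continuous_map_into_fulltopology[OF assms(1)])
    then show "continuous_map X euclideanreal (\<lambda>x. segment S (\<tau> x) (f x) (g x) s)"
      using s by (simp add: segment_def)
    have "(1 - \<tau> x) * f x s + \<tau> x * g x s \<in> {0..1}" if x: "x \<in> topspace X" for x
    proof -
      have "\<tau> x \<in> {0..1}" using assms(1) x by (auto simp: continuous_map_def)
      moreover have "f x s \<in> {0..1}" "g x s \<in> {0..1}"
        using assms(2,3)[THEN continuous_map_funspace, THEN funcset_mem, OF x] ucube_coord_bounds[OF _ s] by auto
      ultimately show ?thesis
        using convexD[of "{0..1::real}" "f x s" "g x s" "1 - \<tau> x" "\<tau> x"] by simp
    qed
    then show "(\<lambda>x. segment S (\<tau> x) (f x) (g x) s) \<in> topspace X \<rightarrow> {0..1}"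
      using s by (simp add: segment_def Pi_iff)
  qed
qed

text \<open>Compactness of [0,1] x K x K, applied to the distance of the endpoints: if they
  coincide, the segment is constant and \<open>f\<close> does not move. Bounding the entire segment
  allows a map to be deformed by sliding its argument.\<close>

lemma segment_small:
  assumes S: "finite S" and f: "continuous_map (ucube S) (mtopology_of m) f" and "0 < \<epsilon>"
  obtains \<delta> where "\<delta> > 0"
    "\<And>x y t. x \<in> topspace (ucube S) \<Longrightarrow> y \<in> topspace (ucube S) \<Longrightarrow> t \<in> {0..1} \<Longrightarrow>
      dist1 S x y < \<delta> \<Longrightarrow> mdist m (f x) (f (segment S t x y)) < \<epsilon>"
proof -
  let ?Z = "prod_topology (top_of_set {0..1::real}) (prod_topology (ucube S) (ucube S))"
  have Z: "compact_space ?Z"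
    by (simp add: compact_space_prod_topology compact_space_ucube compact_space_subtopology)
  have x: "continuous_map ?Z (ucube S) (\<lambda>z. fst (snd z))"
   and y: "continuous_map ?Z (ucube S) (\<lambda>z. snd (snd z))"
    by (intro continuous_map_snd_compose continuous_map_fst continuous_map_snd)+
  have b: "continuous_map ?Z euclideanreal
     (\<lambda>z. mdist m (f (fst (snd z))) (f (segment S (fst z) (fst (snd z)) (snd (snd z)))))"
    by (intro continuous_map_mdist continuous_map_compose2[OF f] continuous_map_segment x y continuous_map_fst)
  have "mdist m (f (fst (snd z))) (f (segment S (fst z) (fst (snd z)) (snd (snd z)))) < \<epsilon>"
    if "z \<in> topspace ?Z" "dist1 S (fst (snd z)) (snd (snd z)) = 0" for z
  proof -
    have z: "fst (snd z) \<in> topspace (ucube S)" "snd (snd z) \<in> topspace (ucube S)"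
      using that(1) by auto
    then have "fst (snd z) = snd (snd z)"
      using that(2) dist1_eq_0[OF S] by blast
    then show ?thesis
      using segment_ends(3)[OF z(1) z(1)] mdist_self[OF continuous_map_mspace[OF f z(1)]] \<open>0 < \<epsilon>\<close> by simp
  qed
  then obtain \<delta> where \<delta>: "\<delta> > 0" "\<And>z. z \<in> topspace ?Z \<Longrightarrow> dist1 S (fst (snd z)) (snd (snd z)) < \<delta> \<Longrightarrow>
      mdist m (f (fst (snd z))) (f (segment S (fst z) (fst (snd z)) (snd (snd z)))) < \<epsilon>"
    using compact_space_control[OF Z continuous_map_dist1[OF S x y] b dist1_nonneg] by blast
  show ?thesis
  proof (rule that[OF \<delta>(1)])
    fix x y and t :: real
    assume "x \<in> topspace (ucube S)" "y \<in> topspace (ucube S)" "t \<in> {0..1}" "dist1 S x y < \<delta>"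
    then show "mdist m (f x) (f (segment S t x y)) < \<epsilon>"
      using \<delta>(2)[of "(t, x, y)"] by simp
  qed
qed

text \<open>First flatten \<^term>\<open>f\<close> near the retract, so that it factors through the retraction there;
  then the homotopy given on the retract is run with a cut-off that vanishes outside the flat part.\<close>
lemma homotopy_extension_from_retract:
  assumes S: "finite S" and f: "continuous_map (ucube S) (mtopology_of m) f"
    and r: "continuous_map (ucube S) (ucube S) r"
    and h: "continuous_map (prod_topology (ucube S) (top_of_set {0..1::real})) (mtopology_of m) h"
    and h0: "\<And>x. x \<in> topspace (ucube S) \<Longrightarrow> h (x, 0) = f (r x)"
    and hsmall: "\<And>x t. x \<in> topspace (ucube S) \<Longrightarrow> t \<in> {0..1} \<Longrightarrow> mdist m (f (r x)) (h (x, t)) < \<epsilon>"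
    and "0 < \<epsilon>"
  obtains f' where "close_homotopic (ucube S) m (2 * \<epsilon>) f f'"
    "\<And>x. x \<in> topspace (ucube S) \<Longrightarrow> r x = x \<Longrightarrow> f' x = h (x, 1)"
proof -
  let ?K = "ucube S"
  let ?I = "top_of_set {0..1::real}"
  let ?KI = "prod_topology ?K ?I"
  obtain \<delta> where \<delta>: "\<delta> > 0"
    "\<And>x y t. x \<in> topspace ?K \<Longrightarrow> y \<in> topspace ?K \<Longrightarrow> t \<in> {0..1} \<Longrightarrow>
      dist1 S x y < \<delta> \<Longrightarrow> mdist m (f x) (f (segment S t x y)) < \<epsilon>"
    using segment_small[OF S f \<open>0 < \<epsilon>\<close>] by blast
  \<comment> \<open>The displacement by \<open>r\<close> in units of \<delta>: below 1, the whole
    segment from \<open>x\<close> to \<open>r x\<close> is harmless for \<open>f\<close>.\<close>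
  define a where "a = (\<lambda>x. dist1 S x (r x) / \<delta>)"
  have a: "continuous_map ?K euclideanreal a"
    unfolding a_def using \<delta>(1)
    by (intro continuous_map_real_divide continuous_map_dist1 S r) auto
  have rK: "r x \<in> topspace ?K" if "x \<in> topspace ?K" for x
    using r that by (auto simp: continuous_map_def)
  \<comment> \<open>The weight is 1 for \<open>a x \<le> 1/2\<close> and 0 for
    \<open>a x \<ge> 1\<close>. So \<open>f1\<close> is \<open>f\<close> after \<open>r\<close> in
    the inner zone, \<open>f\<close> itself in the outer zone, and moves along harmless segments in
    between.\<close>
  define f1 where "f1 = (\<lambda>x. f (segment S (clamp01 (2 - 2 * a x)) x (r x)))"
  have f1: "close_homotopic ?K m \<epsilon> f f1"
    unfolding close_homotopic_def
  proof (intro exI[of _ "\<lambda>z. f (segment S (clamp01 (snd z * clamp01 (2 - 2 * a (fst z)))) (fst z) (r (fst z)))"] conjI ballI)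
    have c: "continuous_map ?KI euclideanreal (\<lambda>z. clamp01 (2 - 2 * a (fst z)))"
      by (intro continuous_map_into_fulltopology[OF continuous_map_clamp01] continuous_intros continuous_map_fst_compose a)
    show "continuous_map ?KI (mtopology_of m)
      (\<lambda>z. f (segment S (clamp01 (snd z * clamp01 (2 - 2 * a (fst z)))) (fst z) (r (fst z))))"
      by (intro continuous_map_compose2[OF f] continuous_map_segment continuous_map_clamp01
           continuous_map_real_mult c continuous_map_snd_real continuous_map_fst continuous_map_fst_compose r)
    fix x assume x: "x \<in> topspace ?K"
    show "f (segment S (clamp01 (snd (x, 0) * clamp01 (2 - 2 * a (fst (x, 0))))) (fst (x, 0)) (r (fst (x, 0)))) = f x"
      using segment_ends[OF x rK[OF x]] by (simp add: clamp01_le0)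
    show "f (segment S (clamp01 (snd (x, 1) * clamp01 (2 - 2 * a (fst (x, 1))))) (fst (x, 1)) (r (fst (x, 1)))) = f1 x"
      by (simp add: f1_def clamp01_id)
    fix t :: real assume t: "t \<in> {0..1}"
    have "mdist m (f x) (f (segment S (clamp01 (t * clamp01 (2 - 2 * a x))) x (r x))) < \<epsilon>"
    proof (cases "a x < 1")
      case True
      then show ?thesis
        using \<delta> x rK[OF x] by (intro \<delta>(2)) (auto simp: a_def)
    next
      case False
      then have "segment S (clamp01 (t * clamp01 (2 - 2 * a x))) x (r x) = x"
        using segment_ends[OF x rK[OF x]] by (simp add: clamp01_le0)
      then show ?thesis
        using mdist_self[OF continuous_map_mspace[OF f x]] \<open>0 < \<epsilon>\<close> by simp
    qed
    then show "mdist m (f x) (f (segment S (clamp01 (snd (x, t) * clamp01 (2 - 2 * a (fst (x, t))))) (fst (x, t)) (r (fst (x, t))))) < \<epsilon>"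
      by simp
  qed
  \<comment> \<open>The cut-off is 1 where \<open>r x = x\<close> and falls to 0 at
    \<open>a x = 1/2\<close>. There \<open>h\<close> is still at its start \<open>f (r x)\<close>,
    which is \<open>f1 x\<close>, so the branches fit together.\<close>
  define H where "H = (\<lambda>z. if a (fst z) \<le> 1/2 then h (fst z, clamp01 (snd z * clamp01 (1 - 2 * a (fst z))))
                            else f1 (fst z))"
  have f1_near: "f1 x = f (r x)" if "x \<in> topspace ?K" "a x \<le> 1/2" for x
    using that segment_ends(2)[OF that(1) rK] by (simp add: f1_def clamp01_ge1)
  have H: "continuous_map ?KI (mtopology_of m) H"
    unfolding H_def
  proof (rule continuous_map_cases_le)
    have c: "continuous_map ?KI euclideanreal (\<lambda>z. clamp01 (1 - 2 * a (fst z)))"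
      by (intro continuous_map_into_fulltopology[OF continuous_map_clamp01] continuous_intros continuous_map_fst_compose a)
    show "continuous_map (subtopology ?KI {z \<in> topspace ?KI. a (fst z) \<le> 1/2}) (mtopology_of m)
       (\<lambda>z. h (fst z, clamp01 (snd z * clamp01 (1 - 2 * a (fst z)))))"
      by (intro continuous_map_from_subtopology continuous_map_compose2[OF h] continuous_map_pairedI continuous_map_clamp01
           continuous_map_real_mult c continuous_map_snd_real continuous_map_fst)
    show "continuous_map (subtopology ?KI {z \<in> topspace ?KI. 1/2 \<le> a (fst z)}) (mtopology_of m) (\<lambda>z. f1 (fst z))"
      by (intro continuous_map_from_subtopology continuous_map_fst_compose close_homotopicD(2)[OF f1])
    show "h (fst z, clamp01 (snd z * clamp01 (1 - 2 * a (fst z)))) = f1 (fst z)"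
      if "z \<in> topspace ?KI" "a (fst z) = 1/2" for z
    proof -
      have "clamp01 (snd z * clamp01 (1 - 2 * a (fst z))) = 0"
        using that by (simp add: clamp01_def)
      then have "h (fst z, clamp01 (snd z * clamp01 (1 - 2 * a (fst z)))) = h (fst z, 0)"
        by (simp only:)
      moreover have "fst z \<in> topspace ?K" using that(1) by auto
      ultimately show ?thesis
        using that(2) h0[of "fst z"] f1_near[of "fst z"] by (simp only: order_refl)
    qed
  qed (simp_all add: continuous_map_fst_compose[OF a])
  define f' where "f' = (\<lambda>x. H (x, 1))"
  have "close_homotopic ?K m \<epsilon> f1 f'"
    unfolding close_homotopic_def
  proof (intro exI[of _ H] conjI ballI H)
    fix x assume x: "x \<in> topspace ?K"
    show "H (x, 0) = f1 x"
      using h0[OF x] f1_near[OF x] by (simp add: H_def clamp01_le0)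
    show "H (x, 1) = f' x"
      by (simp add: f'_def)
    fix t :: real assume "t \<in> {0..1}"
    show "mdist m (f1 x) (H (x, t)) < \<epsilon>"
    proof (cases "a x \<le> 1/2")
      case True
      then show ?thesis
        using hsmall[OF x] f1_near[OF x] by (simp add: H_def)
    next
      case False
      then show ?thesis
        using mdist_self[OF continuous_map_mspace[OF close_homotopicD(2)[OF f1] x]] \<open>0 < \<epsilon>\<close>
        by (simp add: H_def)
    qed
  qed
  then have "close_homotopic ?K m (2 * \<epsilon>) f f'"
    using close_homotopic_trans[OF f1 _ \<open>0 < \<epsilon>\<close>] by simp
  moreover have "f' x = h (x, 1)" if "x \<in> topspace ?K" "r x = x" for x
    using that by (simp add: f'_def H_def a_def dist1_def clamp01_ge1)
  ultimately show ?thesis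
    using that by blast
qed

section \<open>Separating maps on finitely many points and lines\<close>

text \<open>Quantifying over all \<open>f\<close> and \<open>g\<close> makes iteration possible:
  each pair of sets is treated after the maps have already been moved for the earlier pairs.\<close>

definition disjoinable ::
    "'j topology \<Rightarrow> 'k topology \<Rightarrow> 'a metric \<Rightarrow> 'j set \<Rightarrow> 'k set \<Rightarrow> bool"
  where "disjoinable J K m A B \<longleftrightarrow>
    (\<forall>f g. \<forall>\<epsilon>>0. continuous_map J (mtopology_of m) f \<longrightarrow> continuous_map K (mtopology_of m) g \<longrightarrow>
      (\<exists>f' g'. close_homotopic J m \<epsilon> f f' \<and> close_homotopic K m \<epsilon> g g' \<and> f' ` A \<inter> g' ` B = {}))"

lemma disjoinable_sym:
  assumes "disjoinable J K m A B"
  shows "disjoinable K J m B A"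
  unfolding disjoinable_def
proof (intro allI impI)
  fix g f and \<epsilon> :: real
  assume "0 < \<epsilon>" "continuous_map K (mtopology_of m) g" "continuous_map J (mtopology_of m) f"
  then obtain f' g' where "close_homotopic J m \<epsilon> f f'" "close_homotopic K m \<epsilon> g g'" "f' ` A \<inter> g' ` B = {}"
    using assms unfolding disjoinable_def by blast
  then show "\<exists>g' f'. close_homotopic K m \<epsilon> g g' \<and> close_homotopic J m \<epsilon> f f' \<and> g' ` B \<inter> f' ` A = {}"
    by (metis inf_commute)
qed

lemma disjoint_images_gap:
  assumes "compactin J A" "compactin K B"
    and f: "continuous_map J (mtopology_of m) f" and g: "continuous_map K (mtopology_of m) g"
    and "f ` A \<inter> g ` B = {}"
  obtains \<delta> where "\<delta> > 0" "\<And>x y. x \<in> A \<Longrightarrow> y \<in> B \<Longrightarrow> \<delta> \<le> mdist m (f x) (g y)"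
proof -
  let ?Z = "prod_topology (subtopology J A) (subtopology K B)"
  have AB: "A \<subseteq> topspace J" "B \<subseteq> topspace K"
    using assms(1,2) compactin_subset_topspace by auto
  have Z: "compact_space ?Z"
    using assms(1,2) by (simp add: compact_space_prod_topology compact_space_subtopology)
  have a: "continuous_map ?Z euclideanreal (\<lambda>z. mdist m (f (fst z)) (g (snd z)))"
    by (intro continuous_map_mdist continuous_map_fst_compose continuous_map_snd_compose
        continuous_map_from_subtopology f g)
  \<comment> \<open>Since 1 is never below 0, the control lemma with bound 0 says that a distance
    below \<delta> is impossible.\<close>
  have b: "continuous_map ?Z euclideanreal (\<lambda>_. 1)" by simp
  have "(1::real) < 0" if z: "z \<in> topspace ?Z" and 0: "mdist m (f (fst z)) (g (snd z)) = 0" for z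
  proof -
    have A: "fst z \<in> A" and B: "snd z \<in> B"
      using z by auto
    have "f (fst z) = g (snd z)"
      using 0 mdist_zero[OF continuous_map_mspace[OF f subsetD[OF AB(1) A]]
        continuous_map_mspace[OF g subsetD[OF AB(2) B]]] by simp
    then have "f (fst z) \<in> f ` A \<inter> g ` B"
      using A B by (metis IntI image_eqI)
    then show ?thesis
      using assms(5) by simp
  qed
  then obtain \<delta> where \<delta>: "0 < \<delta>" "\<And>z. z \<in> topspace ?Z \<Longrightarrow> mdist m (f (fst z)) (g (snd z)) < \<delta> \<Longrightarrow> (1::real) < 0"
    using compact_space_control[OF Z a b mdist_nonneg] by blast
  show ?thesis
  proof (rule that[OF \<delta>(1)])
    fix x y assume "x \<in> A" "y \<in> B"
    then have "(x, y) \<in> topspace ?Z" using AB by auto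
    then have "\<not> mdist m (f x) (g y) < \<delta>"
      using \<delta>(2)[of "(x, y)"] by auto
    then show "\<delta> \<le> mdist m (f x) (g y)" by simp
  qed
qed

text \<open>Disjoint compact images lie a positive distance apart, and this survives all
  sufficiently small later moves. Hence finitely many pairs can be handled one after
  another.\<close>

lemma disjoinable_finite_family:
  assumes "finite P"
    and P: "\<And>A B. (A, B) \<in> P \<Longrightarrow> compactin J A \<and> compactin K B \<and> disjoinable J K m A B"
    and f: "continuous_map J (mtopology_of m) f" and g: "continuous_map K (mtopology_of m) g"
    and "0 < \<epsilon>"
  obtains f' g' where "close_homotopic J m \<epsilon> f f'" "close_homotopic K m \<epsilon> g g'"
    "\<And>A B. (A, B) \<in> P \<Longrightarrow> f' ` A \<inter> g' ` B = {}"
proof -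
  \<comment> \<open>The induction carries a uniform gap \<delta> instead of mere disjointness, since
    only a gap is stable under further moves.\<close>
  have "\<exists>f' g'. close_homotopic J m \<epsilon> f f' \<and> close_homotopic K m \<epsilon> g g' \<and>
     (\<exists>\<delta>>0. \<forall>(A, B)\<in>P. \<forall>x\<in>A. \<forall>y\<in>B. \<delta> \<le> mdist m (f' x) (g' y))"
    using assms(1) P \<open>0 < \<epsilon>\<close>
  proof (induction P arbitrary: \<epsilon> rule: finite_induct)
    case empty
    then show ?case
      using close_homotopic_refl[OF f empty.prems(2)] close_homotopic_refl[OF g empty.prems(2)] zero_less_one
      by blast
  next
    case (insert p P)
    obtain A B where p: "p = (A, B)" by fastforce
    have AB: "compactin J A" "compactin K B" "disjoinable J K m A B"
      using insert.prems(1)[of A B] p by auto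
    obtain f1 g1 \<delta> where fg1: "close_homotopic J m (\<epsilon>/2) f f1" "close_homotopic K m (\<epsilon>/2) g g1"
      and \<delta>: "\<delta> > 0" "\<And>A B x y. (A, B) \<in> P \<Longrightarrow> x \<in> A \<Longrightarrow> y \<in> B \<Longrightarrow> \<delta> \<le> mdist m (f1 x) (g1 y)"
      using insert.IH[of "\<epsilon>/2"] insert.prems half_gt_zero by (force simp: case_prod_beta)
    \<comment> \<open>Each map moves by less than \<open>\<delta>/3\<close>, so a third of the old
      gap remains; the cap \<open>\<epsilon>/2\<close> keeps the total movement within
      \<epsilon>.\<close>
    define \<eta> where "\<eta> = min (\<epsilon>/2) (\<delta>/3)"
    have \<eta>: "0 < \<eta>" "\<eta> \<le> \<epsilon>/2" "\<eta> \<le> \<delta>/3"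
      using \<delta>(1) insert.prems(2) by (auto simp: \<eta>_def)
    obtain f2 g2 where fg2: "close_homotopic J m \<eta> f1 f2" "close_homotopic K m \<eta> g1 g2" "f2 ` A \<inter> g2 ` B = {}"
      using AB(3) close_homotopicD(2)[OF fg1(1)] close_homotopicD(2)[OF fg1(2)] \<eta>(1)
      unfolding disjoinable_def by blast
    have c2: "continuous_map J (mtopology_of m) f2" "continuous_map K (mtopology_of m) g2"
      using fg2 close_homotopicD(2) by blast+
    obtain \<delta>' where \<delta>': "\<delta>' > 0" "\<And>x y. x \<in> A \<Longrightarrow> y \<in> B \<Longrightarrow> \<delta>' \<le> mdist m (f2 x) (g2 y)"
      using disjoint_images_gap[OF AB(1,2) c2 fg2(3)] by blast
    have old: "\<delta>/3 \<le> mdist m (f2 x) (g2 y)" if q: "(C, D) \<in> P" "x \<in> C" "y \<in> D" for C D x y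
    proof -
      have "compactin J C" "compactin K D"
        using insert.prems(1)[of C D] q(1) by auto
      then have xy: "x \<in> topspace J" "y \<in> topspace K"
        using q compactin_subset_topspace by blast+
      have M: "f1 x \<in> mspace m" "g1 y \<in> mspace m" "f2 x \<in> mspace m" "g2 y \<in> mspace m"
        using continuous_map_mspace[OF close_homotopicD(2)[OF fg1(1)] xy(1)] continuous_map_mspace[OF c2(1) xy(1)]
          continuous_map_mspace[OF close_homotopicD(2)[OF fg1(2)] xy(2)] continuous_map_mspace[OF c2(2) xy(2)]
        by simp_all
      have "mdist m (f1 x) (g1 y) \<le> mdist m (f1 x) (f2 x) + mdist m (f2 x) (g1 y)"
        using M by (intro mdist_triangle)
      moreover have "mdist m (f2 x) (g1 y) \<le> mdist m (f2 x) (g2 y) + mdist m (g1 y) (g2 y)"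
        using M mdist_triangle[of "f2 x" m "g2 y" "g1 y"] by (simp add: mdist_commute)
      ultimately show ?thesis
        using \<delta>(2)[OF q] \<eta>(3) close_homotopicD(3)[OF fg2(1) xy(1)] close_homotopicD(3)[OF fg2(2) xy(2)]
        by linarith
    qed
    have "close_homotopic J m \<epsilon> f f2" "close_homotopic K m \<epsilon> g g2"
      using close_homotopic_mono[OF close_homotopic_trans[OF fg1(1) fg2(1) \<eta>(1)], of \<epsilon>]
        close_homotopic_mono[OF close_homotopic_trans[OF fg1(2) fg2(2) \<eta>(1)], of \<epsilon>] \<eta> by auto
    moreover have "min (\<delta>/3) \<delta>' > 0" using \<delta>(1) \<delta>'(1) by simp
    moreover have "\<forall>(C, D)\<in>insert p P. \<forall>x\<in>C. \<forall>y\<in>D. min (\<delta>/3) \<delta>' \<le> mdist m (f2 x) (g2 y)"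
    proof (intro ballI, clarify)
      fix C D x y assume "(C, D) \<in> insert p P" "x \<in> C" "y \<in> D"
      then show "min (\<delta>/3) \<delta>' \<le> mdist m (f2 x) (g2 y)"
        using old[of C D x y] \<delta>'(2)[of x y] p by auto
    qed
    ultimately show ?case by blast
  qed
  then obtain f' g' \<delta> where fg: "close_homotopic J m \<epsilon> f f'" "close_homotopic K m \<epsilon> g g'"
    and \<delta>: "\<delta> > 0" "\<And>A B x y. (A, B) \<in> P \<Longrightarrow> x \<in> A \<Longrightarrow> y \<in> B \<Longrightarrow> \<delta> \<le> mdist m (f' x) (g' y)"
    by (force simp: case_prod_beta)
  show ?thesis
  proof (rule that[OF fg])
    show "f' ` A \<inter> g' ` B = {}" if q: "(A, B) \<in> P" for A B
    proof (rule ccontr)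
      assume "f' ` A \<inter> g' ` B \<noteq> {}"
      then obtain x y where xy: "x \<in> A" "y \<in> B" "f' x = g' y" by blast
      moreover have "y \<in> topspace K"
        using P[OF q] xy(2) compactin_subset_topspace by blast
      ultimately show False
        using \<delta>(2)[OF q xy(1,2)] \<delta>(1) mdist_self[OF continuous_map_mspace[OF close_homotopicD(2)[OF fg(2)]]]
        by auto
    qed
  qed
qed

section \<open>Pushing points off cells\<close>

lemma topspace_cube_0: "topspace (cube 0) = {\<lambda>_. undefined}"
  by (simp add: cube_def power_topology_def)

lemma open_cover_balls:
  assumes "0 < \<epsilon>"
  shows "open_cover (mtopology_of m) ((\<lambda>c. mball_of m c \<epsilon>) ` mspace m)"
proof -
  interpret Metric_space "mspace m" "mdist m" by (rule Metric_space_mspace_mdist)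
  show ?thesis
    using assms by (auto simp: open_cover_def mball_of_def mtopology_of_def)
qed

text \<open>Every track lies in a ball of radius \<open>\<epsilon>/2\<close>, so the triangle
  inequality through its centre gives \<epsilon>. The homotopy is run backwards because
  \<open>cover_homotopic\<close> leads from the new map to the given one.\<close>

lemma cover_homotopic_balls_imp_close_homotopic:
  assumes "cover_homotopic K (mtopology_of m) ((\<lambda>c. mball_of m c (\<epsilon>/2)) ` mspace m) f' f"
  shows "close_homotopic K m \<epsilon> f f'"
proof -
  let ?I = "top_of_set {0..1::real}"
  obtain h where h: "continuous_map (prod_topology K ?I) (mtopology_of m) h"
    and h0: "\<And>x. x \<in> topspace K \<Longrightarrow> h (x, 0) = f' x" and h1: "\<And>x. x \<in> topspace K \<Longrightarrow> h (x, 1) = f x"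
    and small: "\<And>x. x \<in> topspace K \<Longrightarrow> \<exists>c\<in>mspace m. h ` ({x} \<times> {0..1}) \<subseteq> mball_of m c (\<epsilon>/2)"
    using assms unfolding cover_homotopic_def by (auto simp: image_iff)
  show ?thesis
    unfolding close_homotopic_def
  proof (intro exI[of _ "\<lambda>z. h (fst z, clamp01 (1 - snd z))"] conjI ballI)
    show "continuous_map (prod_topology K ?I) (mtopology_of m) (\<lambda>z. h (fst z, clamp01 (1 - snd z)))"
      by (intro continuous_map_compose2[OF h] continuous_map_pairedI continuous_map_fst continuous_map_clamp01
          continuous_map_diff continuous_map_snd_real) auto
    fix x assume x: "x \<in> topspace K"
    show "h (fst (x, 0), clamp01 (1 - snd (x, 0))) = f x" "h (fst (x, 1), clamp01 (1 - snd (x, 1))) = f' x"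
      using h0[OF x] h1[OF x] by (simp_all add: clamp01_def)
    fix t :: real assume t: "t \<in> {0..1}"
    obtain c where c: "c \<in> mspace m" "h ` ({x} \<times> {0..1}) \<subseteq> mball_of m c (\<epsilon>/2)"
      using small[OF x] by blast
    have "h (x, 1) \<in> mball_of m c (\<epsilon>/2)" "h (x, 1 - t) \<in> mball_of m c (\<epsilon>/2)"
      using t by - (rule subsetD[OF c(2)], force)+
    then have "mdist m c (f x) < \<epsilon>/2" "mdist m c (h (x, 1 - t)) < \<epsilon>/2" "f x \<in> mspace m" "h (x, 1 - t) \<in> mspace m"
      using h1[OF x] by (auto simp: mball_of_def Metric_space.in_mball[OF Metric_space_mspace_mdist])
    moreover have "mdist m (f x) (h (x, 1 - t)) \<le> mdist m c (f x) + mdist m c (h (x, 1 - t))"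
      using mdist_triangle[of "f x" m c "h (x, 1 - t)"] calculation c(1) by (simp add: mdist_commute)
    ultimately show "mdist m (f x) (h (fst (x, t), clamp01 (1 - snd (x, t)))) < \<epsilon>"
      using t by (simp add: clamp01_def)
  qed
qed

text \<open>Since \<open>cube 0\<close> has the single point \<open>\<lambda>_. undefined\<close>, a
  homotopy on it is a path: the property moves \<open>p\<close> along a short path off a slightly
  deformed cell.\<close>

lemma fibered_DD_0_0_homotopies:
  assumes "fibered_DD 0 0 e (mtopology_of m)" and p: "p \<in> mspace m"
    and \<tau>: "continuous_map (cube e) (mtopology_of m) \<tau>" and "0 < \<epsilon>"
  obtains \<gamma> \<sigma> where "close_homotopic (cube 0) m \<epsilon> (\<lambda>_. p) \<gamma>" "close_homotopic (cube e) m \<epsilon> \<tau> \<sigma>"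
    "\<And>w. w \<in> topspace (cube e) \<Longrightarrow> \<gamma> (\<lambda>_. undefined) \<noteq> \<sigma> w"
proof -
  let ?U = "(\<lambda>c. mball_of m c (\<epsilon>/2)) ` mspace m"
  let ?o = "\<lambda>_::nat. undefined::real"
  have "open_cover (mtopology_of m) ?U"
    using \<open>0 < \<epsilon>\<close> by (intro open_cover_balls) auto
  moreover have "continuous_map (prod_topology (cube 0) (cube 0)) (mtopology_of m) (\<lambda>_. p)"
    using p by simp
  moreover have "continuous_map (prod_topology (cube 0) (cube e)) (mtopology_of m) (\<lambda>z. \<tau> (snd z))"
    by (rule continuous_map_snd_compose[OF \<tau>])
  ultimately obtain f' g' where fg:
      "cover_homotopic (prod_topology (cube 0) (cube 0)) (mtopology_of m) ?U f' (\<lambda>_. p)"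
      "cover_homotopic (prod_topology (cube 0) (cube e)) (mtopology_of m) ?U g' (\<lambda>z. \<tau> (snd z))"
    and dis: "\<forall>z\<in>topspace (cube 0). f' ` ({z} \<times> topspace (cube 0)) \<inter> g' ` ({z} \<times> topspace (cube e)) = {}"
    using assms(1) unfolding fibered_DD_def by blast
  have o: "continuous_map (cube e') (prod_topology (cube 0) (cube e')) (\<lambda>w. (?o, w))" for e'
    by (intro continuous_map_pairedI) (auto simp: topspace_cube_0)
  show ?thesis
  proof (rule that)
    show "close_homotopic (cube 0) m \<epsilon> (\<lambda>_. p) (\<lambda>w. f' (?o, w))"
      using close_homotopic_compose[OF cover_homotopic_balls_imp_close_homotopic[OF fg(1)] o] by simp
    show "close_homotopic (cube e) m \<epsilon> \<tau> (\<lambda>w. g' (?o, w))"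
      using close_homotopic_compose[OF cover_homotopic_balls_imp_close_homotopic[OF fg(2)] o] by simp
    show "f' (?o, ?o) \<noteq> g' (?o, w)" if "w \<in> topspace (cube e)" for w
      using dis that by (auto simp: topspace_cube_0)
  qed
qed

text \<open>Think of \<sigma> as parametrising a retract of the cube and of \<open>q\<close> as
  reading off the parameter. A deformation over the parameter space pulls back along
  \<open>q\<close> and then extends from the retract. That extension doubles the bound, hence
  \<open>\<epsilon>/2\<close>.\<close>

lemma close_homotopic_extend:
  assumes S: "finite S" and f: "continuous_map (ucube S) (mtopology_of m) f"
    and q: "continuous_map (ucube S) Q q" and \<sigma>: "continuous_map Q (ucube S) \<sigma>"
    and k: "close_homotopic Q m (\<epsilon>/2) (\<lambda>w. f (\<sigma> w)) k" and "0 < \<epsilon>"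
  obtains f' where "close_homotopic (ucube S) m \<epsilon> f f'"
    "\<And>x. x \<in> topspace (ucube S) \<Longrightarrow> \<sigma> (q x) = x \<Longrightarrow> f' x = k (q x)"
proof -
  let ?I = "top_of_set {0..1::real}"
  obtain h where h: "continuous_map (prod_topology Q ?I) (mtopology_of m) h"
    and e: "\<And>w. w \<in> topspace Q \<Longrightarrow> h (w, 0) = f (\<sigma> w) \<and> h (w, 1) = k w"
    and c: "\<And>w t. w \<in> topspace Q \<Longrightarrow> t \<in> {0..1} \<Longrightarrow> mdist m (f (\<sigma> w)) (h (w, t)) < \<epsilon>/2"
    using k unfolding close_homotopic_def by blast
  have qQ: "q x \<in> topspace Q" if "x \<in> topspace (ucube S)" for x
    using q that by (auto simp: continuous_map_def)
  have hq: "continuous_map (prod_topology (ucube S) ?I) (mtopology_of m) (\<lambda>z. h (q (fst z), snd z))"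
    by (intro continuous_map_compose2[OF h] continuous_map_pairedI continuous_map_fst_compose[OF q] continuous_map_snd)
  show ?thesis
  proof (rule homotopy_extension_from_retract[OF S f continuous_map_compose2[OF \<sigma> q] hq])
    show "h (q (fst (x, 0)), snd (x, 0)) = f (\<sigma> (q x))" if "x \<in> topspace (ucube S)" for x
      using e qQ[OF that] by simp
    show "mdist m (f (\<sigma> (q x))) (h (q (fst (x, t)), snd (x, t))) < \<epsilon>/2"
      if "x \<in> topspace (ucube S)" "t \<in> {0..1}" for x t
      using c[OF qQ[OF that(1)] that(2)] by simp
    show "0 < \<epsilon>/2" using \<open>0 < \<epsilon>\<close> by simp
    fix f' assume f': "close_homotopic (ucube S) m (2 * (\<epsilon>/2)) f f'"
      "\<And>x. x \<in> topspace (ucube S) \<Longrightarrow> \<sigma> (q x) = x \<Longrightarrow> f' x = h (q (fst (x, 1::real)), snd (x, 1::real))"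
    show thesis
    proof (rule that)
      show "close_homotopic (ucube S) m \<epsilon> f f'" using f'(1) by simp
      show "f' x = k (q x)" if "x \<in> topspace (ucube S)" "\<sigma> (q x) = x" for x
        using f'(2)[OF that] e qQ[OF that(1)] by simp
    qed
  qed
qed

text \<open>Both sets are fixed-point sets of maps that factor through a cube: \<open>{v}\<close>
  through \<open>cube 0\<close>, the cell through \<open>cube e\<close>. The moves that the property
  supplies for the point \<open>f v\<close> and the cell \<open>g\<close> after \<sigma> therefore
  extend to the full cubes.\<close>

lemma disjoinable_point_cell:
  assumes "finite S" "finite T" and DD: "fibered_DD 0 0 e (mtopology_of m)"
    and v: "v \<in> topspace (ucube S)"
    and q: "continuous_map (ucube T) (cube e) q" and \<sigma>: "continuous_map (cube e) (ucube T) \<sigma>"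
  shows "disjoinable (ucube S) (ucube T) m {v} {y \<in> topspace (ucube T). \<sigma> (q y) = y}"
  unfolding disjoinable_def
proof (intro allI impI)
  fix f g and \<epsilon> :: real
  assume "0 < \<epsilon>" and f: "continuous_map (ucube S) (mtopology_of m) f"
    and g: "continuous_map (ucube T) (mtopology_of m) g"
  let ?o = "\<lambda>_::nat. undefined::real"
  have half: "0 < \<epsilon>/2" using \<open>0 < \<epsilon>\<close> by simp
  obtain \<gamma> k where \<gamma>: "close_homotopic (cube 0) m (\<epsilon>/2) (\<lambda>_. f v) \<gamma>"
    and k: "close_homotopic (cube e) m (\<epsilon>/2) (\<lambda>w. g (\<sigma> w)) k"
    and ne: "\<And>w. w \<in> topspace (cube e) \<Longrightarrow> \<gamma> ?o \<noteq> k w"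
    using fibered_DD_0_0_homotopies[OF DD continuous_map_mspace[OF f v] continuous_map_compose2[OF g \<sigma>] half]
    by blast
  have c: "continuous_map (ucube S) (cube 0) (\<lambda>_. ?o)" "continuous_map (cube 0) (ucube S) (\<lambda>_. v)"
    using v by (auto simp: topspace_cube_0)
  obtain f' where f': "close_homotopic (ucube S) m \<epsilon> f f'"
    "\<And>x. x \<in> topspace (ucube S) \<Longrightarrow> v = x \<Longrightarrow> f' x = \<gamma> ?o"
    using close_homotopic_extend[OF assms(1) f c \<gamma> \<open>0 < \<epsilon>\<close>] by blast
  obtain g' where g': "close_homotopic (ucube T) m \<epsilon> g g'"
    "\<And>y. y \<in> topspace (ucube T) \<Longrightarrow> \<sigma> (q y) = y \<Longrightarrow> g' y = k (q y)"
    using close_homotopic_extend[OF assms(2) g q \<sigma> k \<open>0 < \<epsilon>\<close>] by blast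
  have "q y \<in> topspace (cube e)" if "y \<in> topspace (ucube T)" for y
    using q that by (auto simp: continuous_map_def)
  then have "f' ` {v} \<inter> g' ` {y \<in> topspace (ucube T). \<sigma> (q y) = y} = {}"
    using f'(2)[OF v] g'(2) ne by auto
  then show "\<exists>f' g'. close_homotopic (ucube S) m \<epsilon> f f' \<and> close_homotopic (ucube T) m \<epsilon> g g' \<and>
      f' ` {v} \<inter> g' ` {y \<in> topspace (ucube T). \<sigma> (q y) = y} = {}"
    using f'(1) g'(1) by blast
qed

definition coord_line :: "'s set \<Rightarrow> ('s \<Rightarrow> real) \<Rightarrow> 's \<Rightarrow> ('s \<Rightarrow> real) set"
  where "coord_line S v s = {x \<in> topspace (ucube S). \<forall>r\<in>S - {s}. x r = v r}"

lemma disjoinable_point_point: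
  assumes "finite S" "finite T" "fibered_DD 0 0 e (mtopology_of m)"
    and "v \<in> topspace (ucube S)" and w: "w \<in> topspace (ucube T)"
  shows "disjoinable (ucube S) (ucube T) m {v} {w}"
proof -
  \<comment> \<open>The constant map to \<open>w\<close> has \<open>w\<close> as its only fixed
    point, whatever the parameter is; the zero vector is a convenient one.\<close>
  have z: "(\<lambda>i\<in>{..<e}. 0) \<in> topspace (cube e)"
    by (auto simp: cube_def power_topology_def)
  have "{y \<in> topspace (ucube T). w = y} = {w}"
    using w by auto
  then show ?thesis
    using disjoinable_point_cell[OF assms(1-4), of "\<lambda>_. \<lambda>i\<in>{..<e}. 0" "\<lambda>_. w"] z w by simp
qed

lemma disjoinable_point_line:
  assumes "finite S" "finite T" "fibered_DD 0 0 e (mtopology_of m)" and e: "0 < e"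
    and "v \<in> topspace (ucube S)" and w: "w \<in> topspace (ucube T)" and s: "s \<in> T"
  shows "disjoinable (ucube S) (ucube T) m {v} (coord_line T w s)"
proof -
  \<comment> \<open>\<open>?q\<close> repeats the free coordinate and \<open>?\<sigma>\<close> reads
    back coordinate 0, which exists as \<open>0 < e\<close>. Their composite keeps
    \<open>y s\<close> and resets all other coordinates to those of \<open>w\<close>, so its fixed
    points form the line.\<close>
  let ?q = "\<lambda>y. \<lambda>i\<in>{..<e}. y s"
  let ?\<sigma> = "\<lambda>c. \<lambda>r\<in>T. if r = s then c 0 else w r"
  have q: "continuous_map (ucube T) (cube e) ?q"
    unfolding cube_def power_topology_def continuous_map_componentwise
    using s continuous_map_ucube_coord by fastforce
  have \<sigma>: "continuous_map (cube e) (ucube T) ?\<sigma>"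
    unfolding continuous_map_ucube_iff
  proof (intro conjI ballI)
    fix r assume r: "r \<in> T"
    have "continuous_map (cube e) (top_of_set {0..1}) (\<lambda>c. c 0)"
      unfolding cube_def power_topology_def using e by (rule continuous_map_product_projection[of 0 "{..<e}" "\<lambda>_. top_of_set {0..1}", simplified]) 
    moreover have "w r \<in> {0..1}"
      using ucube_coord_bounds[OF w r] by auto
    ultimately show "continuous_map (cube e) (top_of_set {0..1}) (\<lambda>c. ?\<sigma> c r)"
      using r by (cases "r = s") (auto simp del: atLeastAtMost_iff)
  qed auto
  have "{y \<in> topspace (ucube T). ?\<sigma> (?q y) = y} = coord_line T w s"
  proof -
    have "?\<sigma> (?q y) = y \<longleftrightarrow> (\<forall>r\<in>T - {s}. y r = w r)" if "y \<in> topspace (ucube T)" for y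
    proof
      show "\<forall>r\<in>T - {s}. y r = w r" if "?\<sigma> (?q y) = y"
      proof
        fix r assume "r \<in> T - {s}"
        then show "y r = w r" using fun_cong[OF that, of r] by simp
      qed
      show "?\<sigma> (?q y) = y" if "\<forall>r\<in>T - {s}. y r = w r"
        using that \<open>y \<in> topspace (ucube T)\<close> e
        by (intro ext) (auto simp: topspace_ucube PiE_def extensional_def)
    qed
    then show ?thesis
      unfolding coord_line_def by blast
  qed
  then show ?thesis
    using disjoinable_point_cell[OF assms(1-3) assms(5) q \<sigma>] by (simp only:)
qed

section \<open>Collapsing cubes onto grids\<close>

text \<open>A sum of N ramps: ramp q climbs from 0 to 1 while \<open>M * N * t\<close> runs from
  \<open>q * M + c\<close> to \<open>q * M + c + 1\<close>. The graph is a staircase whose riser q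
  occupies part number c of the M equal parts of the interval from q/N to (q+1)/N.\<close>

definition collapse :: "nat \<Rightarrow> nat \<Rightarrow> nat \<Rightarrow> real \<Rightarrow> real"
  where "collapse N M c t = (\<Sum>q<N. clamp01 (real M * (real N * t - real q) - real c)) / real N"

text \<open>The open risers of the staircase; at their endpoints the collapse already takes grid
  values.\<close>

definition gap :: "nat \<Rightarrow> nat \<Rightarrow> nat \<Rightarrow> real set"
  where "gap N M c = {t. \<exists>q<N. real (q * M + c) < real (M * N) * t \<and> real (M * N) * t < real (q * M + c + 1)}"

definition grid :: "nat \<Rightarrow> real set"
  where "grid N = (\<lambda>j. real j / real N) ` {..N}"

text \<open>After scaling by \<open>M * N\<close>, a gap becomes unit intervals with integer ends
  whose left ends have residue c modulo M. Open unit intervals of this kind that meet are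
  equal.\<close>

lemma gap_disjoint:
  assumes "c < M" "c' < M" "t \<in> gap N M c" "t \<in> gap N M c'"
  shows "c = c'"
proof -
  obtain q where q: "real (q * M + c) < real (M * N) * t" "real (M * N) * t < real (q * M + c + 1)"
    using assms(3) unfolding gap_def by blast
  obtain q' where q': "real (q' * M + c') < real (M * N) * t" "real (M * N) * t < real (q' * M + c' + 1)"
    using assms(4) unfolding gap_def by blast
  have "real (q * M + c) < real (q' * M + c' + 1)" "real (q' * M + c') < real (q * M + c + 1)"
    using q q' by linarith+
  then have "q * M + c = q' * M + c'"
    unfolding of_nat_less_iff by linarith
  then have "(q * M + c) mod M = (q' * M + c') mod M"
    by (rule arg_cong)
  then show ?thesis
    using assms(1,2) by simp
qed

text \<open>Outside the gaps every ramp has value 0 or 1, so the sum merely counts completed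
  ramps.\<close>

lemma collapse_in_grid:
  assumes "t \<notin> gap N M c"
  shows "collapse N M c t \<in> grid N"
proof -
  let ?y = "\<lambda>q. real M * (real N * t - real q) - real c"
  have "clamp01 (?y q) = of_bool (?y q \<ge> 1)" if "q < N" for q
  proof -
    have "?y q \<le> 0 \<or> 1 \<le> ?y q"
    proof -
      have "real M * (real N * t - real q) = real (M * N) * t - real (q * M)"
        by (simp add: algebra_simps)
      moreover have "\<not> (real (q * M + c) < real (M * N) * t \<and> real (M * N) * t < real (q * M + c + 1))"
        using assms that unfolding gap_def by blast
      ultimately show ?thesis 
        unfolding of_nat_add of_nat_1 by linarith
    qed
    then show ?thesis by (auto simp: clamp01_le0 clamp01_ge1)
  qed
  then have "(\<Sum>q<N. clamp01 (?y q)) = (\<Sum>q<N. of_bool (?y q \<ge> 1))"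
    by (intro sum.cong) auto
  also have "\<dots> = real (card ({..<N} \<inter> {q. ?y q \<ge> 1}))"
    by (rule sum_of_bool_eq) auto
  finally have "collapse N M c t = real (card ({..<N} \<inter> {q. ?y q \<ge> 1})) / real N"
    by (simp add: collapse_def)
  moreover have "card ({..<N} \<inter> {q. ?y q \<ge> 1}) \<le> N"
    using card_mono[of "{..<N}" "{..<N} \<inter> {q. ?y q \<ge> 1}"] by simp
  ultimately show ?thesis
    unfolding grid_def by blast
qed

lemma collapse_bounds: "collapse N M c t \<in> {0..1}"
proof -
  let ?s = "\<Sum>q<N. clamp01 (real M * (real N * t - real q) - real c)"
  have "0 \<le> ?s" by (rule sum_nonneg) simp
  moreover have "?s \<le> (\<Sum>q<N. 1)" by (rule sum_mono) simp
  ultimately show ?thesis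
    by (cases "N = 0") (auto simp: collapse_def divide_simps)
qed

text \<open>At \<open>t\<close> the ramps with index below the floor of \<open>N * t\<close> are
  complete, and those from its ceiling on have not begun. So the sum differs from
  \<open>N * t\<close> by at most 1.\<close>

lemma collapse_close:
  assumes "c < M" "0 < N" "t \<in> {0..1}"
  shows "\<bar>collapse N M c t - t\<bar> \<le> 1 / real N"
proof -
  let ?s = "\<Sum>q<N. clamp01 (real M * (real N * t - real q) - real c)"
  have M: "real M \<ge> real c + 1" using assms(1) by linarith
  have Nt: "0 \<le> real N * t" "real N * t \<le> real N" using assms by (auto simp: mult_left_le)
  have "real (nat \<lfloor>real N * t\<rfloor>) = (\<Sum>q<nat \<lfloor>real N * t\<rfloor>. (1::real))" by simp
  also have "\<dots> = (\<Sum>q<nat \<lfloor>real N * t\<rfloor>. clamp01 (real M * (real N * t - real q) - real c))"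
  proof (rule sum.cong[OF refl])
    fix q assume "q \<in> {..<nat \<lfloor>real N * t\<rfloor>}"
    then have "real N * t - real q \<ge> 1" by (simp; linarith)
    then have "real M * (real N * t - real q) \<ge> real M * 1" by (intro mult_left_mono) auto
    then show "1 = clamp01 (real M * (real N * t - real q) - real c)"
      using M by (intro clamp01_ge1[symmetric]) linarith
  qed
  also have "\<dots> \<le> ?s"
  proof (rule sum_mono2)
    have "nat \<lfloor>real N * t\<rfloor> \<le> N" using Nt by linarith
    then show "{..<nat \<lfloor>real N * t\<rfloor>} \<subseteq> {..<N}" by auto
  qed auto
  finally have lower: "real N * t - 1 \<le> ?s" using Nt by linarith
  have "?s \<le> (\<Sum>q<N. of_bool (q < nat \<lceil>real N * t\<rceil>))"
  proof (rule sum_mono)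
    fix q
    show "clamp01 (real M * (real N * t - real q) - real c) \<le> of_bool (q < nat \<lceil>real N * t\<rceil>)"
    proof (cases "q < nat \<lceil>real N * t\<rceil>")
      case False
      then have "real N * t - real q \<le> 0" by linarith
      then have "real M * (real N * t - real q) \<le> 0" by (intro mult_nonneg_nonpos) auto
      then show ?thesis using False by (simp add: clamp01_le0)
    qed simp
  qed
  also have "\<dots> = real (card ({..<N} \<inter> {q. q < nat \<lceil>real N * t\<rceil>}))"
    by (rule sum_of_bool_eq) simp_all
  also have "\<dots> \<le> real (card {..<nat \<lceil>real N * t\<rceil>})"
    unfolding of_nat_le_iff by (rule card_mono) auto
  finally have upper: "?s \<le> real N * t + 1" using Nt by simp linarith
  have "collapse N M c t - t = (?s - real N * t) / real N"
    using assms(2) by (simp add: collapse_def field_simps)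
  moreover have "\<bar>?s - real N * t\<bar> \<le> 1" using lower upper by linarith
  ultimately show ?thesis
    using assms(2) by (simp add: abs_divide divide_right_mono)
qed

section \<open>Coordinatewise collapse of a cube\<close>

definition collapse_map :: "'s set \<Rightarrow> nat \<Rightarrow> nat \<Rightarrow> nat \<Rightarrow> ('s \<Rightarrow> real) \<Rightarrow> 's \<Rightarrow> real"
  where "collapse_map S N M c x = (\<lambda>s\<in>S. collapse N M c (x s))"

lemma continuous_map_collapse_map: "continuous_map (ucube S) (ucube S) (collapse_map S N M c)"
  unfolding continuous_map_ucube_iff
proof (intro conjI ballI)
  show "collapse_map S N M c \<in> topspace (ucube S) \<rightarrow> extensional S"
    by (auto simp: collapse_map_def)
  fix s assume s: "s \<in> S"
  have x: "continuous_map (ucube S) euclideanreal (\<lambda>x. x s)"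
    by (rule continuous_map_into_fulltopology[OF continuous_map_ucube_coord[OF s]])
  have "continuous_map (ucube S) euclideanreal
      (\<lambda>x. (1 / real N) * (\<Sum>q<N. clamp01 (real M * (real N * x s - real q) - real c)))"
    by (intro continuous_map_real_mult_left continuous_map_sum finite_lessThan
         continuous_map_into_fulltopology[OF continuous_map_clamp01] continuous_map_diff x continuous_map_const[THEN iffD2]) auto
  then have "continuous_map (ucube S) euclideanreal (\<lambda>x. collapse_map S N M c x s)"
    using s by (simp add: collapse_map_def collapse_def)
  moreover have "collapse_map S N M c x s \<in> {0..1}" for x
    using s collapse_bounds[of N M c "x s"] by (simp add: collapse_map_def)
  ultimately show "continuous_map (ucube S) (top_of_set {0..1}) (\<lambda>x. collapse_map S N M c x s)"
    unfolding continuous_map_in_subtopology by blast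
qed

definition grid_points :: "'s set \<Rightarrow> nat \<Rightarrow> ('s \<Rightarrow> real) set"
  where "grid_points S N = PiE S (\<lambda>_. grid N)"

lemma finite_grid_points: "finite S \<Longrightarrow> finite (grid_points S N)"
  unfolding grid_points_def grid_def by (intro finite_PiE) auto

lemma grid_points_in_ucube: "v \<in> grid_points S N \<Longrightarrow> v \<in> topspace (ucube S)"
proof -
  assume "v \<in> grid_points S N"
  moreover have "grid N \<subseteq> {0..1}" by (auto simp: grid_def divide_simps)
  ultimately show "v \<in> topspace (ucube S)"
    unfolding grid_points_def topspace_ucube by (auto simp: PiE_iff)
qed

lemma collapse_map_grid_points:
  assumes "\<And>s. s \<in> S \<Longrightarrow> x s \<notin> gap N M c"
  shows "collapse_map S N M c x \<in> grid_points S N"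
  using assms collapse_in_grid unfolding collapse_map_def grid_points_def by fastforce

lemma collapse_map_coord_line:
  assumes "x \<in> topspace (ucube S)" "r \<in> S" "\<And>s. s \<in> S - {r} \<Longrightarrow> x s \<notin> gap N M c"
  shows "\<exists>v\<in>grid_points S N. collapse_map S N M c x \<in> coord_line S v r"
proof
  \<comment> \<open>Coordinate \<open>r\<close> need not be a grid value after the collapse.
    Resetting it to 0 gives a grid point, and the line in direction \<open>r\<close> still contains
    the collapsed point.\<close>
  let ?v = "(collapse_map S N M c x)(r := 0)"
  have "0 \<in> grid N" unfolding grid_def by (auto intro!: image_eqI[of _ _ 0])
  then show "?v \<in> grid_points S N"
    using assms(2,3) collapse_in_grid unfolding collapse_map_def grid_points_def
    by (auto simp: PiE_iff extensional_def)
  have "collapse_map S N M c x \<in> topspace (ucube S)"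
    using continuous_map_collapse_map assms(1) by (fastforce simp: continuous_map_def)
  then show "collapse_map S N M c x \<in> coord_line S ?v r"
    by (simp add: coord_line_def)
qed

text \<open>A line is a product of the full interval in direction \<open>r\<close> and of singletons
  in the other directions.\<close>

lemma compactin_coord_line:
  assumes "v \<in> topspace (ucube S)"
  shows "compactin (ucube S) (coord_line S v r)"
proof -
  let ?A = "\<lambda>s. if s = r then {0..1} else {v s}"
  have v: "v s \<in> {0..1}" if "s \<in> S" for s
    using ucube_coord_bounds[OF assms that] by simp
  have "coord_line S v r = PiE S ?A"
    unfolding coord_line_def topspace_ucube
  proof (intro set_eqI iffI)
    fix x assume "x \<in> {x \<in> S \<rightarrow>\<^sub>E {0..1}. \<forall>s\<in>S - {r}. x s = v s}"
    then show "x \<in> PiE S ?A" by (auto simp: PiE_iff)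
  next
    fix x assume x: "x \<in> PiE S ?A"
    have "x s \<in> {0..1}" if "s \<in> S" for s
      using PiE_mem[OF x that] v[OF that] by (auto split: if_splits)
    moreover have "x s = v s" if "s \<in> S - {r}" for s
      using PiE_mem[OF x, of s] that by auto
    ultimately show "x \<in> {x \<in> S \<rightarrow>\<^sub>E {0..1}. \<forall>s\<in>S - {r}. x s = v s}"
      using x by (auto simp: PiE_iff)
  qed
  moreover have "compactin (top_of_set {0..1}) (?A s)" if "s \<in> S" for s
    using v[OF that] by (simp add: compactin_subtopology)
  ultimately show ?thesis
    unfolding ucube_def by (simp only: compactin_PiE) blast
qed

text \<open>The order of quantifiers matters: \<open>f1\<close> is chosen after the grid is known,
  so N may depend on \<open>f\<close> but not on \<open>f1\<close>. The deformation slides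
  \<open>f\<close> to \<open>f\<close> after the collapse, then runs the homotopy to
  \<open>f1\<close> on collapsed arguments; each stage costs \<open>\<epsilon>/2\<close>.\<close>

lemma close_homotopic_collapse:
  assumes S: "finite S" and f: "continuous_map (ucube S) (mtopology_of m) f" and "0 < \<epsilon>"
  shows "\<forall>\<^sub>F N in sequentially. \<forall>c<M. \<forall>f1. close_homotopic (ucube S) m (\<epsilon>/2) f f1 \<longrightarrow>
    close_homotopic (ucube S) m \<epsilon> f (\<lambda>x. f1 (collapse_map S N M c x))"
proof -
  let ?K = "ucube S"
  have half: "0 < \<epsilon>/2" using \<open>0 < \<epsilon>\<close> by simp
  obtain \<delta> where \<delta>: "\<delta> > 0"
    "\<And>x y t. x \<in> topspace ?K \<Longrightarrow> y \<in> topspace ?K \<Longrightarrow> t \<in> {0..1} \<Longrightarrow>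
      dist1 S x y < \<delta> \<Longrightarrow> mdist m (f x) (f (segment S t x y)) < \<epsilon>/2"
    using segment_small[OF S f half] by blast
  \<comment> \<open>In the sum distance the collapse moves each of the \<open>card S\<close>
    coordinates by at most 1/N.\<close>
  have "(\<lambda>N. real (card S) / real N) \<longlonglongrightarrow> 0"
    by (rule lim_const_over_n)
  then have "\<forall>\<^sub>F N in sequentially. real (card S) / real N < \<delta>"
    using \<delta>(1) by (rule order_tendstoD)
  then show ?thesis
    using eventually_gt_at_top[of 0]
  proof eventually_elim
    case (elim N)
    show ?case
    proof (intro allI impI)
      fix c f1 assume c: "c < M" and f1: "close_homotopic ?K m (\<epsilon>/2) f f1"
      let ?C = "collapse_map S N M c"
      have CK: "?C x \<in> topspace ?K" if "x \<in> topspace ?K" for x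
        using continuous_map_collapse_map that by (fastforce simp: continuous_map_def)
      have near: "dist1 S x (?C x) < \<delta>" if x: "x \<in> topspace ?K" for x
      proof -
        have "dist1 S x (?C x) \<le> (\<Sum>s\<in>S. 1 / real N)"
          unfolding dist1_def
        proof (rule sum_mono)
          fix s assume s: "s \<in> S"
          show "\<bar>x s - ?C x s\<bar> \<le> 1 / real N"
            using collapse_close[OF c elim(2), of "x s"] ucube_coord_bounds[OF x s] s
            by (simp add: collapse_map_def abs_minus_commute)
        qed
        then show ?thesis using elim(1) by simp
      qed
      have "close_homotopic ?K m (\<epsilon>/2) f (\<lambda>x. f (?C x))"
        unfolding close_homotopic_def
      proof (intro exI[of _ "\<lambda>z. f (segment S (snd z) (fst z) (?C (fst z)))"] conjI ballI)
        show "continuous_map (prod_topology ?K (top_of_set {0..1})) (mtopology_of m)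
            (\<lambda>z. f (segment S (snd z) (fst z) (?C (fst z))))"
          by (intro continuous_map_compose2[OF f] continuous_map_segment continuous_map_snd continuous_map_fst
              continuous_map_fst_compose continuous_map_collapse_map)
        show "f (segment S (snd (x, 0)) (fst (x, 0)) (?C (fst (x, 0)))) = f x"
          and "f (segment S (snd (x, 1)) (fst (x, 1)) (?C (fst (x, 1)))) = f (?C x)" if "x \<in> topspace ?K" for x
          using segment_ends[OF that CK[OF that]] by simp_all
        show "mdist m (f x) (f (segment S (snd (x, t)) (fst (x, t)) (?C (fst (x, t))))) < \<epsilon>/2"
          if "x \<in> topspace ?K" "t \<in> {0..1}" for x t
          using \<delta>(2)[OF that(1) CK[OF that(1)] that(2) near[OF that(1)]] by simp
      qed
      moreover have "close_homotopic ?K m (\<epsilon>/2) (\<lambda>x. f (?C x)) (\<lambda>x. f1 (?C x))"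
        by (rule close_homotopic_compose[OF f1 continuous_map_collapse_map])
      ultimately show "close_homotopic ?K m \<epsilon> f (\<lambda>x. f1 (?C x))"
        using close_homotopic_trans[OF _ _ half] by fastforce
    qed
  qed
qed

text \<open>Pushing precedes collapsing: once the maps differ at all pairs of grid points, composing
  with the collapse spreads this to all points with no coordinate in a gap.\<close>

lemma disjoint_grid_points:
  assumes S: "finite S" and T: "finite T" and DD: "fibered_DD 0 0 e (mtopology_of m)"
    and f: "continuous_map (ucube S) (mtopology_of m) f" and g: "continuous_map (ucube T) (mtopology_of m) g"
    and "0 < \<epsilon>"
  shows "\<forall>\<^sub>F N in sequentially. \<forall>c<M. \<exists>f' g'. close_homotopic (ucube S) m \<epsilon> f f' \<and>
    close_homotopic (ucube T) m \<epsilon> g g' \<and>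
    (\<forall>x\<in>topspace (ucube S). \<forall>y\<in>topspace (ucube T).
      (\<forall>s\<in>S. x s \<notin> gap N M c) \<and> (\<forall>s\<in>T. y s \<notin> gap N M c) \<longrightarrow> f' x \<noteq> g' y)"
  using close_homotopic_collapse[OF S f \<open>0 < \<epsilon>\<close>, of M] close_homotopic_collapse[OF T g \<open>0 < \<epsilon>\<close>, of M]
proof eventually_elim
  case (elim N)
  show ?case
  proof (intro allI impI)
    fix c assume c: "c < M"
    let ?V = "\<lambda>S. (\<lambda>v. {v}) ` grid_points S N"
    have fin: "finite (?V S \<times> ?V T)"
      by (intro finite_cartesian_product finite_UnI finite_imageI finite_grid_points S T)
    have pieces: "compactin (ucube S) A \<and> compactin (ucube T) B \<and> disjoinable (ucube S) (ucube T) m A B"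
      if AB: "(A, B) \<in> ?V S \<times> ?V T" for A B
    proof -
      obtain v w where "A = {v}" "B = {w}" "v \<in> grid_points S N" "w \<in> grid_points T N"
        using AB by auto
      then show ?thesis
        using disjoinable_point_point[OF S T DD] by (simp add: grid_points_in_ucube[of _ _ N])
    qed
    have "0 < \<epsilon>/2" using \<open>0 < \<epsilon>\<close> by simp
    from disjoinable_finite_family[OF fin pieces f g this]
    obtain f1 g1 where f1: "close_homotopic (ucube S) m (\<epsilon>/2) f f1" and g1: "close_homotopic (ucube T) m (\<epsilon>/2) g g1"
      and dis: "\<And>A B. (A, B) \<in> ?V S \<times> ?V T \<Longrightarrow> f1 ` A \<inter> g1 ` B = {}"
      by blast
    show "\<exists>f' g'. close_homotopic (ucube S) m \<epsilon> f f' \<and> close_homotopic (ucube T) m \<epsilon> g g' \<and>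
      (\<forall>x\<in>topspace (ucube S). \<forall>y\<in>topspace (ucube T).
        (\<forall>s\<in>S. x s \<notin> gap N M c) \<and> (\<forall>s\<in>T. y s \<notin> gap N M c) \<longrightarrow> f' x \<noteq> g' y)"
    proof (intro exI conjI ballI impI)
      show "close_homotopic (ucube S) m \<epsilon> f (\<lambda>x. f1 (collapse_map S N M c x))"
        using elim(1) c f1 by blast
      show "close_homotopic (ucube T) m \<epsilon> g (\<lambda>y. g1 (collapse_map T N M c y))"
        using elim(2) c g1 by blast
      fix x y assume "(\<forall>s\<in>S. x s \<notin> gap N M c) \<and> (\<forall>s\<in>T. y s \<notin> gap N M c)"
      then have "collapse_map S N M c x \<in> grid_points S N" "collapse_map T N M c y \<in> grid_points T N"
        using collapse_map_grid_points[of S x N M c] collapse_map_grid_points[of T y N M c] by simp_all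
      then show "f1 (collapse_map S N M c x) \<noteq> g1 (collapse_map T N M c y)"
        using dis[of "{collapse_map S N M c x}" "{collapse_map T N M c y}"] by simp
    qed
  qed
qed

text \<open>At most one gap coordinate in both points together means that one collapsed point is a
  grid point and the other lies at worst on a coordinate line. This is the case that pushing points
  off arcs settles.\<close>

lemma disjoint_grid_lines:
  assumes S: "finite S" and T: "finite T" and DD: "fibered_DD 0 0 e (mtopology_of m)" and e: "0 < e"
    and f: "continuous_map (ucube S) (mtopology_of m) f" and g: "continuous_map (ucube T) (mtopology_of m) g"
    and "0 < \<epsilon>"
  shows "\<forall>\<^sub>F N in sequentially. \<forall>a<M. \<forall>b<M. \<exists>f' g'. close_homotopic (ucube S) m \<epsilon> f f' \<and>
    close_homotopic (ucube T) m \<epsilon> g g' \<and>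
    (\<forall>x\<in>topspace (ucube S). \<forall>y\<in>topspace (ucube T).
      card {s \<in> S. x s \<in> gap N M a} + card {s \<in> T. y s \<in> gap N M b} \<le> 1 \<longrightarrow> f' x \<noteq> g' y)"
  using close_homotopic_collapse[OF S f \<open>0 < \<epsilon>\<close>, of M] close_homotopic_collapse[OF T g \<open>0 < \<epsilon>\<close>, of M]
proof eventually_elim
  case (elim N)
  show ?case
  proof (intro allI impI)
    fix a b assume a: "a < M" and b: "b < M"
    let ?V = "\<lambda>S. (\<lambda>v. {v}) ` grid_points S N"
    let ?E = "\<lambda>S. ?V S \<union> (\<lambda>(v, s). coord_line S v s) ` (grid_points S N \<times> S)"
    \<comment> \<open>No line is paired with a line. Singletons accompany the lines because an empty
      index set has a grid point but no line.\<close>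
    let ?P = "?V S \<times> ?E T \<union> ?E S \<times> ?V T"
    have fin: "finite ?P"
      by (intro finite_cartesian_product finite_UnI finite_imageI finite_grid_points S T)
    have pieces: "compactin (ucube S) A \<and> compactin (ucube T) B \<and> disjoinable (ucube S) (ucube T) m A B"
      if AB: "(A, B) \<in> ?P" for A B
    proof -
      from AB consider
          v w where "A = {v}" "B = {w}" "v \<in> grid_points S N" "w \<in> grid_points T N"
        | v w s where "A = {v}" "B = coord_line T w s" "v \<in> grid_points S N" "w \<in> grid_points T N" "s \<in> T"
        | v w s where "A = coord_line S v s" "B = {w}" "v \<in> grid_points S N" "w \<in> grid_points T N" "s \<in> S"
        by auto
      then show ?thesis
      proof cases
        case 1
        then show ?thesis using disjoinable_point_point[OF S T DD] by (simp add: grid_points_in_ucube[of _ _ N])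
      next
        case 2
        then show ?thesis
          using disjoinable_point_line[OF S T DD e] 
          by (simp add: compactin_coord_line grid_points_in_ucube[of _ _ N])
      next
        case 3
        then show ?thesis
          using disjoinable_sym[OF disjoinable_point_line[OF T S DD e]] 
          by (simp add: compactin_coord_line grid_points_in_ucube[of _ _ N])
      qed
    qed
    have "0 < \<epsilon>/2" using \<open>0 < \<epsilon>\<close> by simp
    from disjoinable_finite_family[OF fin pieces f g this]
    obtain f1 g1 where f1: "close_homotopic (ucube S) m (\<epsilon>/2) f f1" and g1: "close_homotopic (ucube T) m (\<epsilon>/2) g g1"
      and dis: "\<And>A B. (A, B) \<in> ?P \<Longrightarrow> f1 ` A \<inter> g1 ` B = {}"
      by blast
    show "\<exists>f' g'. close_homotopic (ucube S) m \<epsilon> f f' \<and> close_homotopic (ucube T) m \<epsilon> g g' \<and>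
      (\<forall>x\<in>topspace (ucube S). \<forall>y\<in>topspace (ucube T).
        card {s \<in> S. x s \<in> gap N M a} + card {s \<in> T. y s \<in> gap N M b} \<le> 1 \<longrightarrow> f' x \<noteq> g' y)"
    proof (intro exI conjI ballI impI)
      show "close_homotopic (ucube S) m \<epsilon> f (\<lambda>x. f1 (collapse_map S N M a x))"
        using elim(1) a f1 by blast
      show "close_homotopic (ucube T) m \<epsilon> g (\<lambda>y. g1 (collapse_map T N M b y))"
        using elim(2) b g1 by blast
      fix x y assume x: "x \<in> topspace (ucube S)" and y: "y \<in> topspace (ucube T)"
        and few: "card {s \<in> S. x s \<in> gap N M a} + card {s \<in> T. y s \<in> gap N M b} \<le> 1"
      have V: "{collapse_map R N M c z} \<in> ?V R"
        if "finite R" "card {s \<in> R. z s \<in> gap N M c} = 0" for R :: "'r set" and c z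
        using collapse_map_grid_points[of R z N M c] that by auto
      have E: "\<exists>B\<in>?E R. collapse_map R N M c z \<in> B"
        if R: "finite R" and z: "z \<in> topspace (ucube R)" and le: "card {s \<in> R. z s \<in> gap N M c} \<le> 1"
        for R :: "'r set" and c z
      proof (cases "card {s \<in> R. z s \<in> gap N M c} = 0")
        case True
        have "{collapse_map R N M c z} \<in> ?E R"
          using V[OF R True] by (rule UnI1)
        then show ?thesis by (rule bexI[rotated]) simp
      next
        case False
        then have "card {s \<in> R. z s \<in> gap N M c} = 1" using le by simp
        then obtain r where r: "{s \<in> R. z s \<in> gap N M c} = {r}"
          by (rule card_1_singletonE)
        have rR: "r \<in> R" and "\<And>s. s \<in> R - {r} \<Longrightarrow> z s \<notin> gap N M c"
          using r by blast+
        from collapse_map_coord_line[OF z this]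
        obtain v where v: "v \<in> grid_points R N" "collapse_map R N M c z \<in> coord_line R v r"
          by blast
        have "coord_line R v r \<in> ?E R"
          using v(1) rR by (intro UnI2 image_eqI[of _ _ "(v, r)"]) auto
        then show ?thesis using v(2) by (rule bexI[rotated])
      qed
      consider "card {s \<in> S. x s \<in> gap N M a} = 0" "card {s \<in> T. y s \<in> gap N M b} \<le> 1"
        | "card {s \<in> S. x s \<in> gap N M a} \<le> 1" "card {s \<in> T. y s \<in> gap N M b} = 0"
        using few by linarith
      then show "f1 (collapse_map S N M a x) \<noteq> g1 (collapse_map T N M b y)"
      proof cases
        case 1
        obtain B where B: "B \<in> ?E T" "collapse_map T N M b y \<in> B"
          using E[OF T y 1(2)] ..
        have "({collapse_map S N M a x}, B) \<in> ?P"
          by (rule UnI1[OF SigmaI[OF V[OF S 1(1)] B(1)]])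
        from dis[OF this] show ?thesis using B(2) by auto
      next
        case 2
        obtain A where A: "A \<in> ?E S" "collapse_map S N M a x \<in> A"
          using E[OF S x 2(1)] ..
        have "(A, {collapse_map T N M b y}) \<in> ?P"
          by (rule UnI2[OF SigmaI[OF A(1) V[OF T 2(2)]]])
        from dis[OF this] show ?thesis using imageI[OF A(2), of f1] by auto
      qed
    qed
  qed
qed

section \<open>Covers of products of powers\<close>

lemma sum_lessThan_add: "(\<Sum>c<a + b. f c) = (\<Sum>c<a. f c) + (\<Sum>c<b. f (a + c))"
  for f :: "nat \<Rightarrow> nat"
  by (induction b) auto

text \<open>Gaps of different colours are disjoint, so each index is counted for at most one
  colour.\<close>

lemma gap_count:
  assumes "finite A"
  shows "(\<Sum>c<M. card {i \<in> A. z i \<in> gap N M c}) \<le> card A"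
proof -
  have "(\<Sum>c<M. card {i \<in> A. z i \<in> gap N M c}) = card (\<Union>c\<in>{..<M}. {i \<in> A. z i \<in> gap N M c})"
    using assms gap_disjoint by (subst card_UN_disjoint) fastforce+
  also have "\<dots> \<le> card A"
    using assms by (intro card_mono) auto
  finally show ?thesis .
qed

section \<open>Neighbourhoods and Lebesgue numbers in products of powers\<close>

lemma topspace_power: "topspace (power_topology X n) = PiE {..<n} (\<lambda>_. topspace X)"
  by (simp add: power_topology_def)

lemma continuous_map_power_iff:
  "continuous_map Z (power_topology X n) f \<longleftrightarrow>
    f \<in> topspace Z \<rightarrow> extensional {..<n} \<and> (\<forall>i<n. continuous_map Z X (\<lambda>x. f x i))"
  by (auto simp: power_topology_def continuous_map_componentwise)

lemma power_topology_neighbourhood: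
  assumes "openin (power_topology (mtopology_of m) n) V" "v \<in> V"
  shows "\<exists>\<epsilon>>0. \<forall>y\<in>topspace (power_topology (mtopology_of m) n).
    (\<forall>i<n. mdist m (v i) (y i) < \<epsilon>) \<longrightarrow> y \<in> V"
proof -
  obtain B where "\<forall>i\<in>{..<n}. openin (mtopology_of m) (B i)" and B': "v \<in> PiE {..<n} B" "PiE {..<n} B \<subseteq> V"
    using bspec[OF assms(1)[unfolded power_topology_def openin_product_topology_alt] assms(2)] by blast
  then have B: "\<And>i. i < n \<Longrightarrow> openin (mtopology_of m) (B i)"
    by simp
  have "\<exists>r>0. \<forall>u\<in>mspace m. mdist m (v i) u < r \<longrightarrow> u \<in> B i" if i: "i < n" for i
  proof -
    interpret Metric_space "mspace m" "mdist m" by (rule Metric_space_mspace_mdist)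
    have vi: "v i \<in> B i" using PiE_mem[OF B'(1)] i by simp
    then obtain r where r: "r > 0" "mball (v i) r \<subseteq> B i"
      using B[OF i] unfolding mtopology_of_def openin_mtopology by blast
    moreover have "v i \<in> mspace m"
      using openin_subset[OF B[OF i]] vi by auto
    ultimately show ?thesis
      by (auto simp: subset_iff)
  qed
  then obtain r where r: "\<And>i. i < n \<Longrightarrow> r i > 0"
    "\<And>i u. i < n \<Longrightarrow> u \<in> mspace m \<Longrightarrow> mdist m (v i) u < r i \<Longrightarrow> u \<in> B i"
    by metis
  \<comment> \<open>The extra element 1 keeps the minimum meaningful when
    \<open>n = 0\<close>.\<close>
  define \<epsilon> where "\<epsilon> = Min (insert 1 (r ` {..<n}))"
  have "\<epsilon> > 0" using r(1) by (auto simp: \<epsilon>_def)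
  moreover have \<epsilon>: "\<epsilon> \<le> r i" if "i < n" for i
    using that by (simp add: \<epsilon>_def)
  moreover have "y \<in> V" if y: "y \<in> topspace (power_topology (mtopology_of m) n)" and "\<forall>i<n. mdist m (v i) (y i) < \<epsilon>" for y
  proof -
    have "y i \<in> B i" if "i < n" for i
      using r(2)[OF that, of "y i"] \<epsilon>[OF that] y \<open>i < n\<close> \<open>\<forall>i<n. mdist m (v i) (y i) < \<epsilon>\<close>
      unfolding topspace_power by fastforce
    then have "y \<in> PiE {..<n} B"
      using y unfolding topspace_power by (auto simp: PiE_iff)
    then show ?thesis using B'(2) by blast
  qed
  ultimately show ?thesis by blast
qed

text \<open>An l1 distance on the product, kept as a plain function so that bounds in the separate
  factors simply add up.\<close>

definition gauge1 :: "'b metric \<Rightarrow> nat \<Rightarrow> 'a metric \<Rightarrow> nat \<Rightarrow>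
    (nat \<Rightarrow> 'b) \<times> (nat \<Rightarrow> 'a) \<Rightarrow> (nat \<Rightarrow> 'b) \<times> (nat \<Rightarrow> 'a) \<Rightarrow> real"
  where "gauge1 mD d mL l p q =
    (\<Sum>i<d. mdist mD (fst p i) (fst q i)) + (\<Sum>j<l. mdist mL (snd p j) (snd q j))"

abbreviation power_prod :: "'b metric \<Rightarrow> nat \<Rightarrow> 'a metric \<Rightarrow> nat \<Rightarrow> ((nat \<Rightarrow> 'b) \<times> (nat \<Rightarrow> 'a)) topology"
  where "power_prod mD d mL l \<equiv>
    prod_topology (power_topology (mtopology_of mD) d) (power_topology (mtopology_of mL) l)"

lemma gauge1_components:
  "i < d \<Longrightarrow> mdist mD (fst p i) (fst q i) \<le> gauge1 mD d mL l p q"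
  "j < l \<Longrightarrow> mdist mL (snd p j) (snd q j) \<le> gauge1 mD d mL l p q"
proof -
  have nn: "0 \<le> (\<Sum>i<d. mdist mD (fst p i) (fst q i))" "0 \<le> (\<Sum>j<l. mdist mL (snd p j) (snd q j))"
    by (intro sum_nonneg mdist_nonneg)+
  show "mdist mD (fst p i) (fst q i) \<le> gauge1 mD d mL l p q" if "i < d"
    using nn member_le_sum[of i "{..<d}" "\<lambda>i. mdist mD (fst p i) (fst q i)"] that
    unfolding gauge1_def by simp
  show "mdist mL (snd p j) (snd q j) \<le> gauge1 mD d mL l p q" if "j < l"
    using nn member_le_sum[of j "{..<l}" "\<lambda>j. mdist mL (snd p j) (snd q j)"] that
    unfolding gauge1_def by simp
qed

lemma gauge1_triangle:
  assumes "p \<in> topspace (power_prod mD d mL l)" "q \<in> topspace (power_prod mD d mL l)" "r \<in> topspace (power_prod mD d mL l)"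
  shows "gauge1 mD d mL l p r \<le> gauge1 mD d mL l p q + gauge1 mD d mL l q r"
proof -
  have "(\<Sum>i<d. mdist mD (fst p i) (fst r i)) \<le>
      (\<Sum>i<d. mdist mD (fst p i) (fst q i) + mdist mD (fst q i) (fst r i))"
    using assms by (intro sum_mono mdist_triangle) (auto simp: topspace_power PiE_iff)
  moreover have "(\<Sum>i<l. mdist mL (snd p i) (snd r i)) \<le>
      (\<Sum>i<l. mdist mL (snd p i) (snd q i) + mdist mL (snd q i) (snd r i))"
    using assms by (intro sum_mono mdist_triangle) (auto simp: topspace_power PiE_iff)
  ultimately show ?thesis
    unfolding gauge1_def by (simp add: sum.distrib)
qed

lemma gauge1_self: "p \<in> topspace (power_prod mD d mL l) \<Longrightarrow> gauge1 mD d mL l p p = 0"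
  unfolding gauge1_def by (auto simp: topspace_power PiE_iff mdist_self)

lemma continuous_map_power_prod_components:
  assumes "continuous_map K (power_prod mD d mL l) f"
  shows "i < d \<Longrightarrow> continuous_map K (mtopology_of mD) (\<lambda>x. fst (f x) i)"
    and "j < l \<Longrightarrow> continuous_map K (mtopology_of mL) (\<lambda>x. snd (f x) j)"
  using continuous_map_compose2[OF continuous_map_fst assms] continuous_map_compose2[OF continuous_map_snd assms]
  by (simp_all add: continuous_map_power_iff)

lemma power_prod_neighbourhood:
  assumes "openin (power_prod mD d mL l) W" "p \<in> W"
  shows "\<exists>\<epsilon>>0. \<forall>q\<in>topspace (power_prod mD d mL l). gauge1 mD d mL l p q < \<epsilon> \<longrightarrow> q \<in> W"
proof -
  obtain U V where UV: "openin (power_topology (mtopology_of mD) d) U" "openin (power_topology (mtopology_of mL) l) V"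
    "fst p \<in> U" "snd p \<in> V" "U \<times> V \<subseteq> W"
    using assms unfolding openin_prod_topology_alt by (metis prod.collapse)
  obtain \<alpha> where \<alpha>: "\<alpha> > 0" "\<And>y. y \<in> topspace (power_topology (mtopology_of mD) d) \<Longrightarrow>
    (\<forall>i<d. mdist mD (fst p i) (y i) < \<alpha>) \<Longrightarrow> y \<in> U"
    using power_topology_neighbourhood[OF UV(1,3)] by auto
  obtain \<beta> where \<beta>: "\<beta> > 0" "\<And>y. y \<in> topspace (power_topology (mtopology_of mL) l) \<Longrightarrow>
    (\<forall>i<l. mdist mL (snd p i) (y i) < \<beta>) \<Longrightarrow> y \<in> V"
    using power_topology_neighbourhood[OF UV(2,4)] by auto
  show ?thesis
  proof (intro exI[of _ "min \<alpha> \<beta>"] conjI ballI impI)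
    show "min \<alpha> \<beta> > 0" using \<alpha>(1) \<beta>(1) by simp
    fix q assume q: "q \<in> topspace (power_prod mD d mL l)" and g: "gauge1 mD d mL l p q < min \<alpha> \<beta>"
    have "fst q \<in> U"
      using q gauge1_components(1)[of _ d mD p q mL l] g
      by (intro \<alpha>(2)) (auto intro: le_less_trans)
    moreover have "snd q \<in> V"
      using q gauge1_components(2)[of _ l mL p q mD d] g
      by (intro \<beta>(2)) (auto intro: le_less_trans)
    ultimately show "q \<in> W"
      using UV(5) by (metis SigmaI prod.collapse subsetD)
  qed
qed

text \<open>The target need not be compact, but the domain is: finitely many preimages of
  half-radius balls about values of \<open>f\<close> cover it. A bound below all these half radii
  works everywhere by the triangle inequality.\<close>

lemma power_prod_lebesgue:
  assumes K: "compact_space K" and f: "continuous_map K (power_prod mD d mL l) f"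
    and U: "open_cover (power_prod mD d mL l) \<U>"
  shows "\<exists>\<epsilon>>0. \<forall>x\<in>topspace K. \<exists>W\<in>\<U>. \<forall>q\<in>topspace (power_prod mD d mL l).
    gauge1 mD d mL l (f x) q < \<epsilon> \<longrightarrow> q \<in> W"
proof -
  let ?X = "power_prod mD d mL l"
  let ?g = "gauge1 mD d mL l"
  have fX: "f x \<in> topspace ?X" if "x \<in> topspace K" for x
    using continuous_map_funspace[OF f] that by (rule funcset_mem)
  have "\<exists>W r. W \<in> \<U> \<and> r > 0 \<and> (\<forall>q\<in>topspace ?X. ?g (f x) q < r \<longrightarrow> q \<in> W)" if x: "x \<in> topspace K" for x
  proof -
    obtain W where W: "W \<in> \<U>" "f x \<in> W" "openin ?X W"
      using U fX[OF x] unfolding open_cover_def by (metis UnionE)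
    show ?thesis
      using power_prod_neighbourhood[OF W(3,2)] W(1) by blast
  qed
  then obtain W r where Wr: "\<And>x. x \<in> topspace K \<Longrightarrow> W x \<in> \<U>" "\<And>x. x \<in> topspace K \<Longrightarrow> r x > 0"
    "\<And>x q. x \<in> topspace K \<Longrightarrow> q \<in> topspace ?X \<Longrightarrow> ?g (f x) q < r x \<Longrightarrow> q \<in> W x"
    by metis
  define O' where "O' = (\<lambda>x. {y \<in> topspace K. ?g (f x) (f y) \<in> {..<r x/2}})"
  have op: "openin K (O' x)" if x: "x \<in> topspace K" for x
  proof -
    have "continuous_map K euclideanreal (\<lambda>y. ?g (f x) (f y))"
      unfolding gauge1_def
      using continuous_map_power_prod_components[OF f] fX[OF x]
      by (intro continuous_map_add continuous_map_sum continuous_map_mdist) (auto simp: topspace_power PiE_iff)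
    then show ?thesis
      unfolding O'_def by (rule openin_continuous_map_preimage) simp
  qed
  have cov: "topspace K \<subseteq> \<Union>(O' ` topspace K)"
    using gauge1_self[OF fX] Wr(2) by (force simp: O'_def)
  obtain \<F> where \<F>: "finite \<F>" "\<F> \<subseteq> O' ` topspace K" "topspace K \<subseteq> \<Union>\<F>"
    using K cov op unfolding compact_space_def compactin_def by (metis (no_types, lifting) imageE)
  then obtain A where A: "A \<subseteq> topspace K" "finite A" "\<F> = O' ` A"
    by (meson finite_subset_image)
  define \<epsilon> where "\<epsilon> = Min (insert 1 ((\<lambda>x. r x / 2) ` A))"
  have \<epsilon>: "\<epsilon> > 0" "\<And>x. x \<in> A \<Longrightarrow> \<epsilon> \<le> r x / 2"
  proof -
    show "\<epsilon> > 0" using A Wr(2) by (auto simp: \<epsilon>_def)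
    show "\<epsilon> \<le> r x / 2" if "x \<in> A" for x
      unfolding \<epsilon>_def using A(2) that by (intro Min_le) auto
  qed
  have "\<exists>W\<in>\<U>. \<forall>q\<in>topspace ?X. ?g (f x) q < \<epsilon> \<longrightarrow> q \<in> W" if x: "x \<in> topspace K" for x
  proof -
    obtain a where a: "a \<in> A" "x \<in> O' a"
      using \<F>(3) A(3) x by auto
    then have aK: "a \<in> topspace K" using A(1) by auto
    have "q \<in> W a" if q: "q \<in> topspace ?X" "?g (f x) q < \<epsilon>" for q
    proof (rule Wr(3)[OF aK q(1)])
      have "?g (f a) q \<le> ?g (f a) (f x) + ?g (f x) q"
        by (rule gauge1_triangle[OF fX[OF aK] fX[OF x] q(1)])
      also have "\<dots> < r a"
        using a(2) q(2) \<epsilon>(2)[OF a(1)] by (simp add: O'_def)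
      finally show "?g (f a) q < r a" .
    qed
    then show ?thesis using Wr(1)[OF aK] by blast
  qed
  then show ?thesis using \<epsilon>(1) by blast
qed

text \<open>This reduces the problem to single factors: with one \<epsilon> for \<open>f\<close>,
  the coordinate maps may be deformed independently and then reassembled.\<close>

lemma cover_homotopic_componentwise:
  assumes K: "compact_space K" and f: "continuous_map K (power_prod mD d mL l) f"
    and U: "open_cover (power_prod mD d mL l) \<U>"
  shows "\<exists>\<epsilon>>0. \<forall>\<phi> \<psi>.
    (\<forall>i<d. close_homotopic K mD \<epsilon> (\<lambda>x. fst (f x) i) (\<phi> i)) \<longrightarrow>
    (\<forall>j<l. close_homotopic K mL \<epsilon> (\<lambda>x. snd (f x) j) (\<psi> j)) \<longrightarrow>
    continuous_map K (power_prod mD d mL l) (\<lambda>x. (\<lambda>i\<in>{..<d}. \<phi> i x, \<lambda>j\<in>{..<l}. \<psi> j x)) \<and>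
    cover_homotopic K (power_prod mD d mL l) \<U> (\<lambda>x. (\<lambda>i\<in>{..<d}. \<phi> i x, \<lambda>j\<in>{..<l}. \<psi> j x)) f"
proof -
  let ?X = "power_prod mD d mL l"
  let ?g = "gauge1 mD d mL l"
  let ?KI = "prod_topology K (top_of_set {0..1::real})"
  obtain \<epsilon> where \<epsilon>: "\<epsilon> > 0" "\<And>x. x \<in> topspace K \<Longrightarrow> \<exists>W\<in>\<U>. \<forall>q\<in>topspace ?X. ?g (f x) q < \<epsilon> \<longrightarrow> q \<in> W"
    using power_prod_lebesgue[OF K f U] by blast
  \<comment> \<open>The \<open>d + l\<close> components contribute at most \<eta> each; the summand
    1 makes the total strictly smaller than \<epsilon> and avoids division by zero when
    \<open>d = l = 0\<close>.\<close>
  define \<eta> where "\<eta> = \<epsilon> / (d + l + 1)"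
  have \<eta>: "\<eta> > 0" using \<epsilon>(1) by (simp add: \<eta>_def)
  show ?thesis
  proof (intro exI[of _ \<eta>] conjI allI impI \<eta>)
    fix \<phi> \<psi>
    assume "\<forall>i<d. close_homotopic K mD \<eta> (\<lambda>x. fst (f x) i) (\<phi> i)" and "\<forall>j<l. close_homotopic K mL \<eta> (\<lambda>x. snd (f x) j) (\<psi> j)"
    note D = this(1)[rule_format] and L = this(2)[rule_format]
    let ?f' = "\<lambda>x. (\<lambda>i\<in>{..<d}. \<phi> i x, \<lambda>j\<in>{..<l}. \<psi> j x)"
    have fX: "f x \<in> topspace ?X" if "x \<in> topspace K" for x
      using continuous_map_funspace[OF f] that by (rule funcset_mem)
    show "continuous_map K ?X ?f'"
      by (intro continuous_map_pairedI)
         (auto simp: continuous_map_power_iff intro: close_homotopicD(2)[OF D] close_homotopicD(2)[OF L])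
    obtain hD where hD: "\<And>i. i < d \<Longrightarrow> continuous_map ?KI (mtopology_of mD) (hD i)"
      "\<And>i x. i < d \<Longrightarrow> x \<in> topspace K \<Longrightarrow> hD i (x, 0) = fst (f x) i \<and> hD i (x, 1) = \<phi> i x"
      "\<And>i x t. i < d \<Longrightarrow> x \<in> topspace K \<Longrightarrow> t \<in> {0..1} \<Longrightarrow> mdist mD (fst (f x) i) (hD i (x, t)) < \<eta>"
      using D unfolding close_homotopic_def by metis
    obtain hL where hL: "\<And>i. i < l \<Longrightarrow> continuous_map ?KI (mtopology_of mL) (hL i)"
      "\<And>i x. i < l \<Longrightarrow> x \<in> topspace K \<Longrightarrow> hL i (x, 0) = snd (f x) i \<and> hL i (x, 1) = \<psi> i x"
      "\<And>i x t. i < l \<Longrightarrow> x \<in> topspace K \<Longrightarrow> t \<in> {0..1} \<Longrightarrow> mdist mL (snd (f x) i) (hL i (x, t)) < \<eta>"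
      using L unfolding close_homotopic_def by metis
    \<comment> \<open>Time is reversed: the required homotopy ends at \<open>f\<close>, where the
      coordinate homotopies start.\<close>
    define h where "h = (\<lambda>z. (\<lambda>i\<in>{..<d}. hD i (fst z, clamp01 (1 - snd z)), \<lambda>j\<in>{..<l}. hL j (fst z, clamp01 (1 - snd z))))"
    have rev: "continuous_map ?KI ?KI (\<lambda>z. (fst z, clamp01 (1 - snd z)))"
      by (intro continuous_map_pairedI continuous_map_fst continuous_map_clamp01
          continuous_map_diff continuous_map_snd_real) auto
    have h: "continuous_map ?KI ?X h"
      unfolding h_def
      by (intro continuous_map_pairedI)
         (auto simp: continuous_map_power_iff intro: continuous_map_compose2[OF hD(1) rev] continuous_map_compose2[OF hL(1) rev])
    show "cover_homotopic K ?X \<U> ?f' f"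
      unfolding cover_homotopic_def
    proof (intro exI[of _ h] conjI ballI h)
      fix x assume x: "x \<in> topspace K"
      show "h (x, 0) = ?f' x"
        using hD(2)[OF _ x] hL(2)[OF _ x] by (auto simp: h_def clamp01_def)
      have "fst (f x) \<in> extensional {..<d}" "snd (f x) \<in> extensional {..<l}"
        using fX[OF x] by (auto simp: topspace_power PiE_iff)
      then have "restrict (fst (f x)) {..<d} = fst (f x)" "restrict (snd (f x)) {..<l} = snd (f x)"
        by (auto simp: extensional_restrict)
      moreover have "h (x, 1) = (restrict (fst (f x)) {..<d}, restrict (snd (f x)) {..<l})"
        using hD(2)[OF _ x] hL(2)[OF _ x] by (auto simp: h_def clamp01_def)
      ultimately show "h (x, 1) = f x" by simp
      obtain W where W: "W \<in> \<U>" "\<And>q. q \<in> topspace ?X \<Longrightarrow> ?g (f x) q < \<epsilon> \<Longrightarrow> q \<in> W"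
        using \<epsilon>(2)[OF x] by blast
      have "h (x, t) \<in> W" if t: "t \<in> {0..1}" for t
      proof (rule W(2))
        show "h (x, t) \<in> topspace ?X"
          using continuous_map_funspace[OF h] by (rule funcset_mem) (use x t in simp)
        have "?g (f x) (h (x, t)) \<le> (\<Sum>i<d. \<eta>) + (\<Sum>j<l. \<eta>)"
          unfolding gauge1_def
          using hD(3)[OF _ x, of _ "clamp01 (1 - t)"] hL(3)[OF _ x, of _ "clamp01 (1 - t)"]
          by (intro add_mono sum_mono) (auto simp: h_def less_imp_le)
        also have "\<dots> < (d + l + 1) * \<eta>"
          using \<eta> by (simp add: algebra_simps)
        also have "\<dots> = \<epsilon>" by (simp add: \<eta>_def)
        finally show "?g (f x) (h (x, t)) < \<epsilon>" .
      qed
      then show "\<exists>W\<in>\<U>. h ` ({x} \<times> {0..1}) \<subseteq> W"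
        using W(1) by blast
    qed
  qed
qed

section \<open>The product theorem\<close>

definition split_coords :: "nat \<Rightarrow> nat \<Rightarrow> (nat + nat \<Rightarrow> real) \<Rightarrow> (nat \<Rightarrow> real) \<times> (nat \<Rightarrow> real)"
  where "split_coords m n w = (\<lambda>i\<in>{..<m}. w (Inl i), \<lambda>j\<in>{..<n}. w (Inr j))"

definition join_coords :: "nat \<Rightarrow> nat \<Rightarrow> (nat \<Rightarrow> real) \<times> (nat \<Rightarrow> real) \<Rightarrow> nat + nat \<Rightarrow> real"
  where "join_coords m n p = (\<lambda>s\<in>{..<m} <+> {..<n}. case_sum (fst p) (snd p) s)"

lemma cube_eq_ucube: "cube n = ucube {..<n}"
  by (simp add: cube_def power_topology_def ucube_def)

lemma compact_space_cube_prod: "compact_space (prod_topology (cube m) (cube n))"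
  by (simp add: compact_space_prod_topology cube_eq_ucube compact_space_ucube)

lemma split_join_coords:
  assumes "p \<in> topspace (prod_topology (cube m) (cube n))"
  shows "split_coords m n (join_coords m n p) = p"
proof -
  have "fst p \<in> extensional {..<m}" "snd p \<in> extensional {..<n}"
    using assms by (auto simp: cube_eq_ucube topspace_ucube PiE_iff)
  moreover have "split_coords m n (join_coords m n p) = (restrict (fst p) {..<m}, restrict (snd p) {..<n})"
    by (auto simp: split_coords_def join_coords_def fun_eq_iff)
  ultimately show ?thesis
    by (simp add: extensional_restrict)
qed

lemma continuous_map_split_coords:
  "continuous_map (ucube ({..<m} <+> {..<n})) (prod_topology (cube m) (cube n)) (split_coords m n)"
  unfolding split_coords_def cube_eq_ucube
  by (intro continuous_map_pairedI)
     (auto simp: continuous_map_ucube_iff intro: continuous_map_ucube_coord)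

lemma continuous_map_join_coords:
  "continuous_map (prod_topology (cube m) (cube n)) (ucube ({..<m} <+> {..<n})) (join_coords m n)"
  unfolding continuous_map_ucube_iff
proof (intro conjI ballI)
  show "join_coords m n \<in> topspace (prod_topology (cube m) (cube n)) \<rightarrow> extensional ({..<m} <+> {..<n})"
    by (auto simp: join_coords_def)
  fix s assume "s \<in> {..<m} <+> {..<n}"
  then show "continuous_map (prod_topology (cube m) (cube n)) (top_of_set {0..1}) (\<lambda>x. join_coords m n x s)"
    unfolding cube_eq_ucube join_coords_def
    by (auto intro: continuous_map_fst_compose[OF continuous_map_ucube_coord]
        continuous_map_snd_compose[OF continuous_map_ucube_coord])
qed

lemma close_homotopic_join_coords:
  assumes "close_homotopic (ucube ({..<m} <+> {..<n})) \<mu> \<epsilon> (\<lambda>w. \<phi> (split_coords m n w)) \<phi>'"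
  shows "close_homotopic (prod_topology (cube m) (cube n)) \<mu> \<epsilon> \<phi> (\<lambda>p. \<phi>' (join_coords m n p))"
  using close_homotopic_compose[OF assms continuous_map_join_coords]
  unfolding close_homotopic_def by (simp only: split_join_coords cong: ball_cong)

lemma card_join_coords_gap:
  "card {s \<in> {..<m} <+> {..<n}. join_coords m n (z, x) s \<in> A} =
    card {i \<in> {..<m}. z i \<in> A} + card {j \<in> {..<n}. x j \<in> A}"
proof -
  have "{s \<in> {..<m} <+> {..<n}. join_coords m n (z, x) s \<in> A} =
      {i \<in> {..<m}. z i \<in> A} <+> {j \<in> {..<n}. x j \<in> A}"
    by (auto simp: join_coords_def)
  then show ?thesis
    by (simp add: card_Plus)
qed

theorem theorem13:
  fixes m n k d l :: nat
    and L :: "'a topology" and D :: "'b topology"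
  assumes "metrizable_space L" and "metrizable_space D"
    and "fibered_DD 0 0 0 L"
    and "fibered_DD 0 0 (d + l) D"
    and "m + n + k < 2 * d + l"
  shows "fibered_DD m n k (prod_topology (power_topology D d) (power_topology L l))"
proof -
  obtain mL where mL: "L = mtopology_of mL"
    using assms(1) Metric_space.mtopology_of unfolding metrizable_space_def by metis
  obtain mD where mD: "D = mtopology_of mD"
    using assms(2) Metric_space.mtopology_of unfolding metrizable_space_def by metis
  have DL: "fibered_DD 0 0 0 (mtopology_of mL)" and DD: "fibered_DD 0 0 (d + l) (mtopology_of mD)"
    using assms(3,4) mL mD by simp_all
  \<comment> \<open>The strict dimension bound excludes \<open>d = l = 0\<close>, so the cells in D
    have a coordinate that can parametrise a line.\<close>
  have pos: "0 < d + l" using assms(5) by linarith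
  let ?X = "power_prod mD d mL l"
  let ?P = "prod_topology (cube m) (cube n)" and ?Q = "prod_topology (cube m) (cube k)"
  let ?S = "{..<m} <+> {..<n}" and ?T = "{..<m} <+> {..<k}"
  let ?M = "2 * d + l"
  have fin: "finite ?S" "finite ?T" by simp_all
  show ?thesis
    unfolding fibered_DD_def mL mD
  proof (intro allI impI)
    fix \<U> f g
    assume U: "open_cover ?X \<U>" and f: "continuous_map ?P ?X f" and g: "continuous_map ?Q ?X g"
    obtain \<epsilon>1 where \<epsilon>1: "\<epsilon>1 > 0" "\<And>\<phi> \<psi>.
      (\<And>i. i < d \<Longrightarrow> close_homotopic ?P mD \<epsilon>1 (\<lambda>x. fst (f x) i) (\<phi> i)) \<Longrightarrow>
      (\<And>j. j < l \<Longrightarrow> close_homotopic ?P mL \<epsilon>1 (\<lambda>x. snd (f x) j) (\<psi> j)) \<Longrightarrow>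
      continuous_map ?P ?X (\<lambda>x. (\<lambda>i\<in>{..<d}. \<phi> i x, \<lambda>j\<in>{..<l}. \<psi> j x)) \<and>
      cover_homotopic ?P ?X \<U> (\<lambda>x. (\<lambda>i\<in>{..<d}. \<phi> i x, \<lambda>j\<in>{..<l}. \<psi> j x)) f"
      using cover_homotopic_componentwise[OF compact_space_cube_prod f U] by (elim exE conjE) simp
    obtain \<epsilon>2 where \<epsilon>2: "\<epsilon>2 > 0" "\<And>\<phi> \<psi>.
      (\<And>i. i < d \<Longrightarrow> close_homotopic ?Q mD \<epsilon>2 (\<lambda>x. fst (g x) i) (\<phi> i)) \<Longrightarrow>
      (\<And>j. j < l \<Longrightarrow> close_homotopic ?Q mL \<epsilon>2 (\<lambda>x. snd (g x) j) (\<psi> j)) \<Longrightarrow>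
      continuous_map ?Q ?X (\<lambda>x. (\<lambda>i\<in>{..<d}. \<phi> i x, \<lambda>j\<in>{..<l}. \<psi> j x)) \<and>
      cover_homotopic ?Q ?X \<U> (\<lambda>x. (\<lambda>i\<in>{..<d}. \<phi> i x, \<lambda>j\<in>{..<l}. \<psi> j x)) g"
      using cover_homotopic_componentwise[OF compact_space_cube_prod g U] by (elim exE conjE) simp
    define \<epsilon> where "\<epsilon> = min \<epsilon>1 \<epsilon>2"
    have \<epsilon>: "0 < \<epsilon>" "\<epsilon> \<le> \<epsilon>1" "\<epsilon> \<le> \<epsilon>2"
      using \<epsilon>1(1) \<epsilon>2(1) by (auto simp: \<epsilon>_def)
    have fD: "continuous_map (ucube ?S) (mtopology_of mD) (\<lambda>w. fst (f (split_coords m n w)) i)"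
      and gD: "continuous_map (ucube ?T) (mtopology_of mD) (\<lambda>w. fst (g (split_coords m k w)) i)" if "i < d" for i
      using continuous_map_compose2[OF continuous_map_power_prod_components(1)[OF f that] continuous_map_split_coords]
        continuous_map_compose2[OF continuous_map_power_prod_components(1)[OF g that] continuous_map_split_coords]
      by simp_all
    have fL: "continuous_map (ucube ?S) (mtopology_of mL) (\<lambda>w. snd (f (split_coords m n w)) j)"
      and gL: "continuous_map (ucube ?T) (mtopology_of mL) (\<lambda>w. snd (g (split_coords m k w)) j)" if "j < l" for j
      using continuous_map_compose2[OF continuous_map_power_prod_components(2)[OF f that] continuous_map_split_coords]
        continuous_map_compose2[OF continuous_map_power_prod_components(2)[OF g that] continuous_map_split_coords]
      by simp_all
    define PD where "PD = (\<lambda>N i a b f' g'.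
      close_homotopic (ucube ?S) mD \<epsilon> (\<lambda>w. fst (f (split_coords m n w)) i) f' \<and>
      close_homotopic (ucube ?T) mD \<epsilon> (\<lambda>w. fst (g (split_coords m k w)) i) g' \<and>
      (\<forall>x\<in>topspace (ucube ?S). \<forall>y\<in>topspace (ucube ?T).
        card {s \<in> ?S. x s \<in> gap N ?M a} + card {s \<in> ?T. y s \<in> gap N ?M b} \<le> 1 \<longrightarrow> f' x \<noteq> g' y))"
    define PL where "PL = (\<lambda>N j c f' g'.
      close_homotopic (ucube ?S) mL \<epsilon> (\<lambda>w. snd (f (split_coords m n w)) j) f' \<and>
      close_homotopic (ucube ?T) mL \<epsilon> (\<lambda>w. snd (g (split_coords m k w)) j) g' \<and>
      (\<forall>x\<in>topspace (ucube ?S). \<forall>y\<in>topspace (ucube ?T).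
        (\<forall>s\<in>?S. x s \<notin> gap N ?M c) \<and> (\<forall>s\<in>?T. y s \<notin> gap N ?M c) \<longrightarrow> f' x \<noteq> g' y))"
    \<comment> \<open>Statements that hold eventually for finitely many factors share one N, and the
      disjointness of the colours requires a single mesh.\<close>
    have evD: "\<forall>\<^sub>F N in sequentially. \<forall>i\<in>{..<d}. \<forall>a<?M. \<forall>b<?M. \<exists>f' g'. PD N i a b f' g'"
      unfolding PD_def
      by (intro eventually_ball_finite finite_lessThan ballI disjoint_grid_lines[OF fin DD pos fD gD \<epsilon>(1)]) auto
    have evL: "\<forall>\<^sub>F N in sequentially. \<forall>j\<in>{..<l}. \<forall>c<?M. \<exists>f' g'. PL N j c f' g'"
      unfolding PL_def
      by (intro eventually_ball_finite finite_lessThan ballI disjoint_grid_points[OF fin DL fL gL \<epsilon>(1)]) auto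
    obtain N where ND: "\<forall>i\<in>{..<d}. \<forall>a<?M. \<forall>b<?M. \<exists>f' g'. PD N i a b f' g'"
      and NL: "\<forall>j\<in>{..<l}. \<forall>c<?M. \<exists>f' g'. PL N j c f' g'"
      using eventually_happens'[OF sequentially_bot eventually_conj[OF evD evL]] by blast
    \<comment> \<open>The pairs \<open>i\<close>, \<open>d + i\<close> use up the colours below
      \<open>2 * d\<close>, leaving \<open>2 * d + j\<close> for the factors L, so no colour serves
      two factors.\<close>
    have "\<exists>f' g'. PD N i i (d + i) f' g'" if "i < d" for i
      using ND that by simp
    then obtain FD GD where FGD: "\<And>i. i < d \<Longrightarrow> PD N i i (d + i) (FD i) (GD i)"
      by metis
    have "\<exists>f' g'. PL N j (2 * d + j) f' g'" if "j < l" for j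
      using NL that by simp
    then obtain FL GL where FGL: "\<And>j. j < l \<Longrightarrow> PL N j (2 * d + j) (FL j) (GL j)"
      by metis
    define f' where "f' = (\<lambda>p. (\<lambda>i\<in>{..<d}. FD i (join_coords m n p), \<lambda>j\<in>{..<l}. FL j (join_coords m n p)))"
    define g' where "g' = (\<lambda>p. (\<lambda>i\<in>{..<d}. GD i (join_coords m k p), \<lambda>j\<in>{..<l}. GL j (join_coords m k p)))"
    have f': "continuous_map ?P ?X f' \<and> cover_homotopic ?P ?X \<U> f' f"
      unfolding f'_def
    proof (rule \<epsilon>1(2))
      show "close_homotopic ?P mD \<epsilon>1 (\<lambda>x. fst (f x) i) (\<lambda>p. FD i (join_coords m n p))" if "i < d" for i
        using FGD[OF that] unfolding PD_def by (intro close_homotopic_mono[OF close_homotopic_join_coords \<epsilon>(2)]) auto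
      show "close_homotopic ?P mL \<epsilon>1 (\<lambda>x. snd (f x) j) (\<lambda>p. FL j (join_coords m n p))" if "j < l" for j
        using FGL[OF that] unfolding PL_def by (intro close_homotopic_mono[OF close_homotopic_join_coords \<epsilon>(2)]) auto
    qed
    have g': "continuous_map ?Q ?X g' \<and> cover_homotopic ?Q ?X \<U> g' g"
      unfolding g'_def
    proof (rule \<epsilon>2(2))
      show "close_homotopic ?Q mD \<epsilon>2 (\<lambda>x. fst (g x) i) (\<lambda>p. GD i (join_coords m k p))" if "i < d" for i
        using FGD[OF that] unfolding PD_def by (intro close_homotopic_mono[OF close_homotopic_join_coords \<epsilon>(3)]) auto
      show "close_homotopic ?Q mL \<epsilon>2 (\<lambda>x. snd (g x) j) (\<lambda>p. GL j (join_coords m k p))" if "j < l" for j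
        using FGL[OF that] unfolding PL_def by (intro close_homotopic_mono[OF close_homotopic_join_coords \<epsilon>(3)]) auto
    qed
    have "f' (z, x) \<noteq> g' (z, y)"
      if z: "z \<in> topspace (cube m)" and x: "x \<in> topspace (cube n)" and y: "y \<in> topspace (cube k)" for z x y
    proof
      assume eq: "f' (z, x) = g' (z, y)"
      let ?w = "join_coords m n (z, x)" and ?w' = "join_coords m k (z, y)"
      let ?zc = "\<lambda>c. card {i \<in> {..<m}. z i \<in> gap N ?M c}"
      let ?xc = "\<lambda>c. card {i \<in> {..<n}. x i \<in> gap N ?M c}"
      let ?yc = "\<lambda>c. card {i \<in> {..<k}. y i \<in> gap N ?M c}"
      \<comment> \<open>Coordinates of \<open>z\<close> enter once although they belong to both
        points; this makes the total at most \<open>m + n + k\<close> instead of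
        \<open>2 * m + n + k\<close>.\<close>
      define \<nu> where "\<nu> = (\<lambda>c. ?zc c + ?xc c + ?yc c)"
      have w: "?w \<in> topspace (ucube ?S)" "?w' \<in> topspace (ucube ?T)"
        using continuous_map_funspace[OF continuous_map_join_coords] z x y by (auto simp: Pi_iff)
      \<comment> \<open>The first count involves \<open>z\<close> and \<open>x\<close> in colour
        \<open>i\<close>, the second \<open>z\<close> and \<open>y\<close> in colour
        \<open>d + i\<close>. They are parts of different values of \<nu>, so their sum is at most
        \<open>\<nu> i + \<nu> (d + i)\<close>.\<close>
      have \<nu>D: "2 \<le> \<nu> i + \<nu> (d + i)" if i: "i < d" for i
      proof -
        have "FD i ?w = GD i ?w'"
          using eq i by (auto simp: f'_def g'_def fun_eq_iff restrict_def dest: spec[of _ i])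
        then have "\<not> card {s \<in> ?S. ?w s \<in> gap N ?M i} + card {s \<in> ?T. ?w' s \<in> gap N ?M (d + i)} \<le> 1"
          using FGD[OF i] w unfolding PD_def by blast
        then show ?thesis
          unfolding card_join_coords_gap \<nu>_def by linarith
      qed
      \<comment> \<open>Here both counts contain the same \<open>z\<close>-part, so only one bad
        coordinate is guaranteed.\<close>
      have \<nu>L: "1 \<le> \<nu> (2 * d + j)" if j: "j < l" for j
      proof (rule ccontr)
        assume "\<not> 1 \<le> \<nu> (2 * d + j)"
        then have "card {s \<in> ?S. ?w s \<in> gap N ?M (2 * d + j)} = 0" "card {s \<in> ?T. ?w' s \<in> gap N ?M (2 * d + j)} = 0"
          unfolding card_join_coords_gap \<nu>_def by linarith+
        then have "(\<forall>s\<in>?S. ?w s \<notin> gap N ?M (2 * d + j)) \<and> (\<forall>s\<in>?T. ?w' s \<notin> gap N ?M (2 * d + j))"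
          using fin by (simp add: card_eq_0_iff)
        then have "FL j ?w \<noteq> GL j ?w'"
          using FGL[OF j] w unfolding PL_def by blast
        then show False
          using eq j by (auto simp: f'_def g'_def fun_eq_iff restrict_def dest: spec[of _ j])
      qed
      \<comment> \<open>Double counting of pairs of a colour and a coordinate in its gap: from below
        factor by factor, from above coordinate by coordinate.\<close>
      have "?M = (\<Sum>i<d. 2) + (\<Sum>j<l. 1)" by simp
      also have "\<dots> \<le> (\<Sum>i<d. \<nu> i + \<nu> (d + i)) + (\<Sum>j<l. \<nu> (2 * d + j))"
        using \<nu>D \<nu>L by (intro add_mono sum_mono) auto
      also have "\<dots> = (\<Sum>c<?M. \<nu> c)"
        by (simp add: sum_lessThan_add sum.distrib mult_2)
      also have "\<dots> = (\<Sum>c<?M. ?zc c) + (\<Sum>c<?M. ?xc c) + (\<Sum>c<?M. ?yc c)"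
        by (simp add: \<nu>_def sum.distrib)
      also have "\<dots> \<le> card {..<m} + card {..<n} + card {..<k}"
        by (intro add_mono gap_count) simp_all
      finally show False using assms(5) by simp
    qed
    then have "\<forall>z\<in>topspace (cube m). f' ` ({z} \<times> topspace (cube n)) \<inter> g' ` ({z} \<times> topspace (cube k)) = {}"
      by (force simp: image_iff)
    then show "\<exists>f' g'. continuous_map ?P ?X f' \<and> continuous_map ?Q ?X g' \<and>
        cover_homotopic ?P ?X \<U> f' f \<and> cover_homotopic ?Q ?X \<U> g' g \<and>
        (\<forall>z\<in>topspace (cube m). f' ` ({z} \<times> topspace (cube n)) \<inter> g' ` ({z} \<times> topspace (cube k)) = {})"
      using f' g' by (intro exI[of _ f'] exI[of _ g']) simp
  qed
qed

end
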